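(* Let $G=(V,E)$ be a finite simple, unweighted, undirected graph with adjacency matrix $g$ and degrees $k_i$, and use the notation, summation conventions and graphlets defined in the context. Then the following identities hold. (a) $|M_{75}^{(5)}| = \sum_{i:k_{i} > 3}\binom{k_{i}}{4} = \frac{1}{24} \sum_{i:k_{i} > 3}k_{i} (k_{i}-1)(k_{i}-2)(k_{i}-3)$. (b) $|M_{77}^{(5)}| = \sum_{(i,j)^{\star} \in E,\ k_{i} > 2} \binom{k_{i}-1}{2}(k_{j}-1) - 2 |M_{15}^{(4)}| = \frac{1}{2}\sum_{(i,j)^{\star} \in E,\ k_{i} > 2}(k_{i} - 1)(k_{i} - 2)(k_{j} - 1) - 2 |M_{15}^{(4)}|$. (c) $|M_{79}^{(5)}| = \frac{1}{2}\sum_{i:k_{i} > 3}(g^{3})_{ii} \binom{k_{i}-2}{2} = \frac{1}{4} \sum_{i:k_{i}>3}(g^{3})_{ii}(k_{i}-2)(k_{i}-3)$. (d) $|M_{86}^{(5)}| = \frac{1}{2}\sum_{i,j:i \neq j} (g^{4})_{ij} - 2|M_{3}^{(3)}| - 9 |M_{7}^{(3)}| - 3 |M_{11}^{(4)}| - 2 |M_{13}^{(4)}| - 2 |M_{15}^{(4)}|$. (e) $|M_{87}^{(5)}| = \sum_{(i, j) \in E,\ k_{i} > 2,\ k_{j} > 2} (g^{2})_{ij} (k_{i}-2)(k_{j}-2) - 2 |M_{31}^{(4)}|$. (f) $|M_{94}^{(5)}| = \sum_{i,j:i \neq j,\ k_{i} > 2} \binom{(g^{2})_{ij}}{2}(k_{i}-2)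 - 2 |M_{31}^{(4)}| = \frac{1}{2} \sum_{i,j:i \neq j,\ k_{i} > 2} (g^{2})_{ij}((g^{2})_{ij} - 1)(k_{i}-2) - 2 |M_{31}^{(4)}|$. (g) $|M_{95}^{(5)}| = \sum_{i,j:i \neq j,\ k_{i} > 3} \binom{(g^{2})_{ij}(g)_{ij}}{2}(k_{i}-3) = \frac{1}{2} \sum_{(i,j)^{\star} \in E,\ k_{i} > 3} (g^{2})_{ij}((g^{2})_{ij} - 1)(k_{i}-3)$. (h) $|M_{117}^{(5)}| = \frac{1}{2} \sum_{(i, j)^{\star} \in E} (g^{3})_{ii} (k_{j}-1) - 6 |M_{7}^{(3)}| - 2 |M_{15}^{(4)}| - 4 |M_{31}^{(4)}|$. (i) $|M_{119}^{(5)}| = \sum_{(i, j) \in E,\ k_{i} > 2,\ k_{j} > 2} ((g^{2})_{ij} - 1) \sum_{r \in S(i, j),\ k_{r} > 1}(k_{r} - 2) - 12 |M_{63}^{(4)}|$. (j) $|M_{127}^{(5)}| = \sum_{i:k_{i} > 3}|M_{7}^{(3)}(g_{-i})|\,(k_{i} - 3) = \frac{1}{6} \sum_{i:k_{i} > 3} \operatorname{tr}(g_{-i}^{3}) (k_{i} - 3)$. (k) $|M_{222}^{(5)}| = \frac{1}{2} \sum_{i,j:i \neq j,\ k_{i}>2,\ k_{j}>2}\binom{(g^{2})_{ij}}{3} = \frac{1}{12} \sum_{i,j:i \neq j,\ k_{i}>2,\ k_{j}>2} (g^{2})_{ij}((g^{2})_{ij}-1)((g^{2})_{ij}-2)$.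 (l) $|M_{223}^{(5)}| = \frac{1}{2} \sum_{i,j:i \neq j,\ k_{i}>3,\ k_{j}>3}\binom{(g^{2})_{ij}(g)_{ij}}{3} = \frac{1}{6}\sum_{(i,j) \in E,\ k_{i}>3,\ k_{j}>3} (g^{2})_{ij}((g^{2})_{ij}-1)((g^{2})_{ij}-2)$. (m) $|M_{235}^{(5)}| = \sum_{i:k_{i}>2}\binom{\frac{1}{2}(g^{3})_{ii}}{2} - 2 |M_{31}^{(4)}| = \frac{1}{8} \sum_{i:k_{i}>2}(g^{3})_{ii}((g^{3})_{ii}-2) - 2 |M_{31}^{(4)}|$. (n) $|M_{236}^{(5)}| = \frac{1}{10}\left(\operatorname{tr}(g^{5}) - 30 |M_{7}^{(3)}| - 10 |M_{15}^{(4)}|\right)$. (o) $|M_{237}^{(5)}| = \sum_{(i,j) \in E} (g^{3})_{ij}(g^{2})_{ij} - 9 |M_{7}^{(3)}| - 2 |M_{15}^{(4)}| - 4 |M_{31}^{(4)}|$. (p) $|M_{239}^{(5)}| = \sum_{i:k_{i} > 3}|M_{13}^{(4)}(g_{-i})| = \sum_{i:k_{i}>3}\Big(\sum_{\{j, r\} \in E(\Gamma_{G}(i))}(d_i(j)-1)(d_i(r)-1) - 3 |M_{7}^{(3)}(g_{-i})|\Big)$. (q) $|M_{254}^{(5)}| = \sum_{(i, j) \in E,\ k_{i} > 2,\ k_{j} > 2} \ \sum_{\{r, q\} \subseteq S(i, j),\ r \neq q,\ k_{r} > 2,\ k_{q} > 2} ((g^{2})_{rq} - 2)$, where the inner sum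 is over unordered pairs $\{r,q\}$. (r) $|M_{255}^{(5)}| = \frac{1}{2}\sum_{i:k_{i} > 3}|M_{15}^{(4)}(g_{-i})| = \frac{1}{4} \sum_{i:k_{i}>3} \ \sum_{r \in \Gamma_G(i):\ d_i(r) > 2} (g_{-i}^{3})_{rr}(d_i(r)-2)$. (s) $|M_{507}^{(5)}| = \sum_{i:k_{i} > 3}|M_{30}^{(4)}(g_{-i})| = \frac{1}{8} \sum_{i:k_{i}>3} \left(\operatorname{tr}(g_{-i}^{4}) - 2 m(g_{-i}) - 4 |M_{3}^{(3)}(g_{-i})|\right)$. (t) $|M_{511}^{(5)}| = \frac{1}{3}\sum_{i:k_{i} > 3}|M_{31}^{(4)}(g_{-i})| = \frac{1}{6} \sum_{i:k_{i} > 3}\ \sum_{r,s \in \Gamma_G(i):\ r \neq s,\ d_i(r) > 2,\ d_i(s) > 2}\binom{(g_{-i}^{2})_{rs} (g_{-i})_{rs}}{2}$. (u) $|M_{1023}^{(5)}| = \frac{1}{5} \sum_{i:k_{i} > 3} |M_{63}^{(4)} (g_{-i}) | = \frac{1}{120} \sum_{i:k_{i} > 3} \ \sum_{j \in \Gamma_{G}(i),\ k_{j} > 2}\operatorname{tr}\big(((g_{-i})_{-j})^{3}\big)$.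
   Context: $G=(V,E)$ is a finite simple undirected unweighted graph; $g$ is its adjacency matrix ($(g)_{ij}=1$ if $\{i,j\}\in E$, else $0$; $(g)_{ii}=0$); $k_i=\sum_j (g)_{ij}$ is the degree of $i$; $(g^r)_{ij}$ is the $(i,j)$ entry of the $r$-th matrix power; $\operatorname{tr}$ is the trace. $\Gamma_G(i)$ is the set of neighbours of $i$, and $S(i,j)=\Gamma_G(i)\cap\Gamma_G(j)$ (so $|S(i,j)|=(g^2)_{ij}$ for $i\ne j$). For a vertex $i$, $g_{-i}$ denotes the adjacency matrix (rows/columns indexed by $\Gamma_G(i)$) of the induced subgraph $G[\Gamma_G(i)]$; $E(\Gamma_G(i))$ is its edge set, $m(g_{-i})$ its number of edges, and $d_i(r)$ the degree of $r$ in $G[\Gamma_G(i)]$; for $j\in\Gamma_G(i)$, $(g_{-i})_{-j}$ is the adjacency matrix of $G[\Gamma_G(i)\cap\Gamma_G(j)]$. Summation conventions: $\sum_{i,j:i\neq j}$ is over ordered pairs of distinct vertices; $\sum_{(i,j)\in E}$ is over edges, each edge counted once; $\sum_{(i,j)^\star\in E}$ is over ordered pairs $(i,j)$ with $\{i,j\}\in E$ (each edge in both orientations); further conditions written under a sum restrict the terms. $\binom{x}{r}=x(x-1)\cdots(x-r+1)/r!$. For a graph $H$ with adjacency matrix $h$ and a fixed graph $F$, $|F(h)|$ is the number of (not necessarily induced) subgraphs of $H$ (a vertex subset together with an edge subset) isomorphic to $F$; $|F|$ means $|F(g)|$. Graphlets (edge sets on vertex set $\{1,\dots,b\}$): $M_3^{(3)}$: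 $\{13,23\}$; $M_7^{(3)}$: triangle; $M_{11}^{(4)}$: $\{14,24,34\}$; $M_{13}^{(4)}$: $\{14,34,23\}$; $M_{15}^{(4)}$: $\{14,23,24,34\}$; $M_{30}^{(4)}$: $\{13,14,23,24\}$; $M_{31}^{(4)}$: $\{13,14,23,24,34\}$; $M_{63}^{(4)}$: $K_4$. $M_{75}^{(5)}$: $\{15,25,35,45\}$; $M_{77}^{(5)}$: $\{15,25,35,34\}$; $M_{79}^{(5)}$: $\{15,25,34,35,45\}$; $M_{86}^{(5)}$: $\{15,24,34,35\}$; $M_{87}^{(5)}$: $\{15,24,34,35,45\}$; $M_{94}^{(5)}$: $\{15,24,25,34,35\}$; $M_{95}^{(5)}$: $\{15,24,25,34,35,45\}$; $M_{117}^{(5)}$: $\{15,23,24,34,45\}$; $M_{119}^{(5)}$: $\{15,23,24,34,35,45\}$; $M_{127}^{(5)}$: $\{15,23,24,25,34,35,45\}$; $M_{222}^{(5)}$: $\{14,15,24,25,34,35\}$; $M_{223}^{(5)}$: $\{14,15,24,25,34,35,45\}$; $M_{235}^{(5)}$: $\{14,15,23,25,35,45\}$; $M_{236}^{(5)}$: $\{14,15,23,25,34\}$; $M_{237}^{(5)}$: $\{14,15,23,25,34,45\}$; $M_{239}^{(5)}$: $\{14,15,23,25,34,35,45\}$; $M_{254}^{(5)}$: $\{14,15,23,24,25,34,35\}$; $M_{255}^{(5)}$: $\{14,15,23,24,25,34,35,45\}$; $M_{507}^{(5)}$: $\{13,14,15,23,24,25,35,45\}$; $M_{511}^{(5)}$: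 all pairs except $12$; $M_{1023}^{(5)}$: $K_5$. *)

theory Defs
  imports Complex_Main
begin

type_synonym 'a graph = "'a set \<times> 'a set set"

abbreviation verts :: "'a graph \<Rightarrow> 'a set" where "verts G \<equiv> fst G"
abbreviation edges :: "'a graph \<Rightarrow> 'a set set" where "edges G \<equiv> snd G"

definition finite_simple_graph :: "'a graph \<Rightarrow> bool" where
  "finite_simple_graph G \<longleftrightarrow> finite (verts G) \<and> (\<forall>e\<in>edges G. e \<subseteq> verts G \<and> card e = 2)"

definition nbrs :: "'a graph \<Rightarrow> 'a \<Rightarrow> 'a set" where
  "nbrs G i = {j \<in> verts G. {i, j} \<in> edges G}"

definition common_nbrs :: "'a graph \<Rightarrow> 'a \<Rightarrow> 'a \<Rightarrow> 'a set" where
  "common_nbrs G i j = nbrs G i \<inter> nbrs G j"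

definition induced :: "'a graph \<Rightarrow> 'a set \<Rightarrow> 'a graph" where
  "induced G W = (W, {e \<in> edges G. e \<subseteq> W})"

definition nbhd_graph :: "'a graph \<Rightarrow> 'a \<Rightarrow> 'a graph" where
  "nbhd_graph G i = induced G (nbrs G i)"

text \<open>A square matrix with rows and columns indexed by a finite set \<open>I\<close> is a function of two
  arguments, of which only the values on \<open>I\<close> matter. This lets the submatrices indexed by vertex
  neighbourhoods live in the same type as the full adjacency matrix.\<close>

definition mat_mult :: "'a set \<Rightarrow> ('a \<Rightarrow> 'a \<Rightarrow> real) \<Rightarrow> ('a \<Rightarrow> 'a \<Rightarrow> real) \<Rightarrow> 'a \<Rightarrow> 'a \<Rightarrow> real" where
  "mat_mult I A B i j = (\<Sum>l\<in>I. A i l * B l j)"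

primrec mat_pow :: "'a set \<Rightarrow> ('a \<Rightarrow> 'a \<Rightarrow> real) \<Rightarrow> nat \<Rightarrow> 'a \<Rightarrow> 'a \<Rightarrow> real" where
  "mat_pow I A 0 = (\<lambda>i j. if i = j then 1 else 0)"
| "mat_pow I A (Suc r) = mat_mult I (mat_pow I A r) A"

definition mat_trace :: "'a set \<Rightarrow> ('a \<Rightarrow> 'a \<Rightarrow> real) \<Rightarrow> real" where
  "mat_trace I A = (\<Sum>i\<in>I. A i i)"

definition adj :: "'a graph \<Rightarrow> 'a \<Rightarrow> 'a \<Rightarrow> real" where
  "adj G i j = (if {i, j} \<in> edges G then 1 else 0)"

definition adj_pow :: "'a graph \<Rightarrow> nat \<Rightarrow> 'a \<Rightarrow> 'a \<Rightarrow> real" where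
  "adj_pow G r = mat_pow (verts G) (adj G) r"

definition adj_pow_trace :: "'a graph \<Rightarrow> nat \<Rightarrow> real" where
  "adj_pow_trace G r = mat_trace (verts G) (adj_pow G r)"

definition deg :: "'a graph \<Rightarrow> 'a \<Rightarrow> real" where
  "deg G i = (\<Sum>j\<in>verts G. adj G i j)"

definition distinct_pairs :: "'a set \<Rightarrow> ('a \<times> 'a) set" where
  "distinct_pairs W = {(i, j). i \<in> W \<and> j \<in> W \<and> i \<noteq> j}"

definition arcs :: "'a graph \<Rightarrow> ('a \<times> 'a) set" where
  "arcs G = {(i, j). {i, j} \<in> edges G}"

text \<open>For a set \<open>P\<close> of unordered pairs, \<open>orient P\<close> contains exactly one of the ordered pairs
  \<open>(i, j)\<close>, \<open>(j, i)\<close> for each \<open>{i, j} \<in> P\<close>. Sums over unordered pairs are taken over it; their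
  summands and side conditions are symmetric, so the choice of orientation is irrelevant.\<close>

definition orient :: "'a set set \<Rightarrow> ('a \<times> 'a) set" where
  "orient P = (\<lambda>e. SOME p. e = {fst p, snd p}) ` P"

definition unordered_pairs :: "'a set \<Rightarrow> 'a set set" where
  "unordered_pairs W = {p. p \<subseteq> W \<and> card p = 2}"

definition graph_iso :: "'a graph \<Rightarrow> 'b graph \<Rightarrow> bool" where
  "graph_iso G H \<longleftrightarrow> (\<exists>f. bij_betw f (verts G) (verts H) \<and>
     (\<forall>u\<in>verts G. \<forall>v\<in>verts G. {u, v} \<in> edges G \<longleftrightarrow> {f u, f v} \<in> edges H))"

definition subgraphs :: "'a graph \<Rightarrow> 'a graph set" where
  "subgraphs H = {(W, F). W \<subseteq> verts H \<and> F \<subseteq> edges H \<and> (\<forall>e\<in>F. e \<subseteq> W)}"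

definition count_sub :: "nat graph \<Rightarrow> 'a graph \<Rightarrow> real" where
  "count_sub F H = real (card {K \<in> subgraphs H. graph_iso K F})"

definition M3 :: "nat graph" where
  "M3 = ({1..3}, {{1, 3}, {2, 3}})"
definition M7 :: "nat graph" where
  "M7 = ({1..3}, {{1, 2}, {1, 3}, {2, 3}})"
definition M11 :: "nat graph" where
  "M11 = ({1..4}, {{1, 4}, {2, 4}, {3, 4}})"
definition M13 :: "nat graph" where
  "M13 = ({1..4}, {{1, 4}, {3, 4}, {2, 3}})"
definition M15 :: "nat graph" where
  "M15 = ({1..4}, {{1, 4}, {2, 3}, {2, 4}, {3, 4}})"
definition M30 :: "nat graph" where
  "M30 = ({1..4}, {{1, 3}, {1, 4}, {2, 3}, {2, 4}})"
definition M31 :: "nat graph" where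
  "M31 = ({1..4}, {{1, 3}, {1, 4}, {2, 3}, {2, 4}, {3, 4}})"
definition M63 :: "nat graph" where
  "M63 = ({1..4}, {{1, 2}, {1, 3}, {1, 4}, {2, 3}, {2, 4}, {3, 4}})"
definition M75 :: "nat graph" where
  "M75 = ({1..5}, {{1, 5}, {2, 5}, {3, 5}, {4, 5}})"
definition M77 :: "nat graph" where
  "M77 = ({1..5}, {{1, 5}, {2, 5}, {3, 5}, {3, 4}})"
definition M79 :: "nat graph" where
  "M79 = ({1..5}, {{1, 5}, {2, 5}, {3, 4}, {3, 5}, {4, 5}})"
definition M86 :: "nat graph" where
  "M86 = ({1..5}, {{1, 5}, {2, 4}, {3, 4}, {3, 5}})"
definition M87 :: "nat graph" where
  "M87 = ({1..5}, {{1, 5}, {2, 4}, {3, 4}, {3, 5}, {4, 5}})"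
definition M94 :: "nat graph" where
  "M94 = ({1..5}, {{1, 5}, {2, 4}, {2, 5}, {3, 4}, {3, 5}})"
definition M95 :: "nat graph" where
  "M95 = ({1..5}, {{1, 5}, {2, 4}, {2, 5}, {3, 4}, {3, 5}, {4, 5}})"
definition M117 :: "nat graph" where
  "M117 = ({1..5}, {{1, 5}, {2, 3}, {2, 4}, {3, 4}, {4, 5}})"
definition M119 :: "nat graph" where
  "M119 = ({1..5}, {{1, 5}, {2, 3}, {2, 4}, {3, 4}, {3, 5}, {4, 5}})"
definition M127 :: "nat graph" where
  "M127 = ({1..5}, {{1, 5}, {2, 3}, {2, 4}, {2, 5}, {3, 4}, {3, 5}, {4, 5}})"
definition M222 :: "nat graph" where
  "M222 = ({1..5}, {{1, 4}, {1, 5}, {2, 4}, {2, 5}, {3, 4}, {3, 5}})"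
definition M223 :: "nat graph" where
  "M223 = ({1..5}, {{1, 4}, {1, 5}, {2, 4}, {2, 5}, {3, 4}, {3, 5}, {4, 5}})"
definition M235 :: "nat graph" where
  "M235 = ({1..5}, {{1, 4}, {1, 5}, {2, 3}, {2, 5}, {3, 5}, {4, 5}})"
definition M236 :: "nat graph" where
  "M236 = ({1..5}, {{1, 4}, {1, 5}, {2, 3}, {2, 5}, {3, 4}})"
definition M237 :: "nat graph" where
  "M237 = ({1..5}, {{1, 4}, {1, 5}, {2, 3}, {2, 5}, {3, 4}, {4, 5}})"
definition M239 :: "nat graph" where
  "M239 = ({1..5}, {{1, 4}, {1, 5}, {2, 3}, {2, 5}, {3, 4}, {3, 5}, {4, 5}})"
definition M254 :: "nat graph" where
  "M254 = ({1..5}, {{1, 4}, {1, 5}, {2, 3}, {2, 4}, {2, 5}, {3, 4}, {3, 5}})"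
definition M255 :: "nat graph" where
  "M255 = ({1..5}, {{1, 4}, {1, 5}, {2, 3}, {2, 4}, {2, 5}, {3, 4}, {3, 5}, {4, 5}})"
definition M507 :: "nat graph" where
  "M507 = ({1..5}, {{1, 3}, {1, 4}, {1, 5}, {2, 3}, {2, 4}, {2, 5}, {3, 5}, {4, 5}})"
definition M511 :: "nat graph" where
  "M511 = ({1..5}, {{1, 3}, {1, 4}, {1, 5}, {2, 3}, {2, 4}, {2, 5}, {3, 4}, {3, 5}, {4, 5}})"
definition M1023 :: "nat graph" where
  "M1023 = ({1..5}, {{1, 2}, {1, 3}, {1, 4}, {1, 5}, {2, 3}, {2, 4}, {2, 5}, {3, 4}, {3, 5}, {4, 5}})"

end

theory Submission
  imports Defs
begin

text \<open>
  Write \<open>a\<close> for the adjacency matrix. The number of subgraphs isomorphic to \<open>F\<close>, multiplied by the number of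
  automorphisms of \<open>F\<close>, is the sum over all tuples of distinct vertices of the product of \<open>a x y\<close> over the
  edges of \<open>F\<close>. In such a sum the last vertex can be summed out: the sum over the vertices different
  from the earlier ones is the sum over all vertices, which is a degree or an entry of a power of \<open>a\<close>,
  minus the finitely many coincidences with earlier vertices. Each coincidence is again a sum over
  tuples of distinct vertices and counts a smaller graphlet; these are the correction terms in the
  formulas. The degree restrictions in the sums only drop terms that vanish, and graphlets with a vertex
  adjacent to all others are counted inside the neighbourhoods of such a vertex.
\<close>

section \<open>Labelled embeddings and subgraph counts\<close>

text \<open>The order of the variables matters. A vertex can be removed only if at most two of the
  remaining ones are joined to it in the graphlet, since a product of three entries does not sum to
  an entry of a power. What it leaves behind is a real weight that the next removal has to absorb,
  for example \<open>a i v * g2 v j\<close> into \<open>g3 i j\<close>. In \<open>M507\<close>,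
  \<open>M511\<close> and \<open>M1023\<close> every vertex has at least three neighbours, so no
  removal is possible and only the passage to neighbourhoods helps. The automorphism numbers are
  found by enumerating all arrangements of the vertices of a graphlet, so that no symmetry is argued
  by hand. Degrees and powers are real numbers: \<open>k i - 3\<close> does not truncate, but
  integrality is lost. It is recovered from cardinalities of neighbourhoods when terms of small
  degree are dropped, because a product such as \<open>k i * (k i - 1) * (k i - 2)\<close> vanishes
  at the small integers and nowhere between them.\<close>

definition pattern :: "nat \<Rightarrow> (nat \<times> nat) list \<Rightarrow> nat graph" where
  "pattern n es = ({..<n}, (\<lambda>(p, q). {p, q}) ` set es)"

text \<open>Lists stand for injective maps from positions to vertices. Edges must go to edges while
  non-edges are free, in line with counting subgraphs that need not be induced.\<close>

definition embeddings :: "nat \<Rightarrow> (nat \<times> nat) list \<Rightarrow> 'a graph \<Rightarrow> 'a list set" where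
  "embeddings n es G = {xs. length xs = n \<and> distinct xs \<and> set xs \<subseteq> verts G \<and>
     (\<forall>(p, q)\<in>set es. {xs ! p, xs ! q} \<in> edges G)}"

text \<open>Serves twice: it gives the subgraph traced out by an embedding, and it renames the
  positions of a pattern to the labels of a graphlet such as \<open>M7\<close>.\<close>

definition image_graph :: "(nat \<times> nat) list \<Rightarrow> 'a list \<Rightarrow> 'a graph" where
  "image_graph es xs = (set xs, (`) ((!) xs) ` edges (pattern (length xs) es))"

definition pattern_edges :: "nat \<Rightarrow> (nat \<times> nat) list \<Rightarrow> bool" where
  "pattern_edges n es \<longleftrightarrow> (\<forall>(p, q)\<in>set es. p < n \<and> q < n \<and> p \<noteq> q)"

lemma edges_image_graph:
  "edges (image_graph es xs) = (\<lambda>(p, q). {xs ! p, xs ! q}) ` set es"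
  by (simp add: image_graph_def pattern_def image_image case_prod_beta)

lemma graph_iso_trans:
  assumes "graph_iso G H" "graph_iso H K"
  shows "graph_iso G K"
proof -
  obtain f where f: "bij_betw f (verts G) (verts H)"
    "\<forall>u\<in>verts G. \<forall>v\<in>verts G. {u, v} \<in> edges G \<longleftrightarrow> {f u, f v} \<in> edges H"
    using assms(1) unfolding graph_iso_def by blast
  obtain h where h: "bij_betw h (verts H) (verts K)"
    "\<forall>u\<in>verts H. \<forall>v\<in>verts H. {u, v} \<in> edges H \<longleftrightarrow> {h u, h v} \<in> edges K"
    using assms(2) unfolding graph_iso_def by blast
  have "bij_betw (h \<circ> f) (verts G) (verts K)"
    using f(1) h(1) by (rule bij_betw_trans)
  moreover have "\<forall>u\<in>verts G. \<forall>v\<in>verts G. {u, v} \<in> edges G \<longleftrightarrow> {(h \<circ> f) u, (h \<circ> f) v} \<in> edges K"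
    using f(2) h(2) bij_betw_apply[OF f(1)] by simp
  ultimately show ?thesis unfolding graph_iso_def by blast
qed

lemma graph_iso_sym:
  assumes "graph_iso G H"
  shows "graph_iso H G"
proof -
  obtain f where f: "bij_betw f (verts G) (verts H)"
    "\<forall>u\<in>verts G. \<forall>v\<in>verts G. {u, v} \<in> edges G \<longleftrightarrow> {f u, f v} \<in> edges H"
    using assms(1) unfolding graph_iso_def by blast
  let ?h = "the_inv_into (verts G) f"
  have inj: "inj_on f (verts G)" and im: "f ` verts G = verts H"
    using f(1) by (auto simp: bij_betw_def)
  have 1: "bij_betw ?h (verts H) (verts G)"
    using f(1) by (rule bij_betw_the_inv_into)
  have 2: "f (?h u) = u" if "u \<in> verts H" for u
    using f_the_inv_into_f[OF inj] that im by simp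
  have "\<forall>u\<in>verts H. \<forall>v\<in>verts H. {u, v} \<in> edges H \<longleftrightarrow> {?h u, ?h v} \<in> edges G"
    using f(2) 2 bij_betw_apply[OF 1] by simp
  with 1 show ?thesis unfolding graph_iso_def by blast
qed

lemma inj_on_image_edges:
  assumes "distinct xs" "\<Union>P \<subseteq> {..<length xs}"
  shows "inj_on ((`) ((!) xs)) P"
proof -
  have "inj_on ((!) xs) {..<length xs}"
    using assms(1) by (simp add: inj_on_nth)
  then have "inj_on ((`) ((!) xs)) (Pow {..<length xs})"
    by (rule inj_on_image_Pow)
  then show ?thesis
    by (rule inj_on_subset) (use assms(2) in auto)
qed

lemma Union_pattern_edges:
  assumes "pattern_edges n es"
  shows "\<Union>(edges (pattern n es)) \<subseteq> {..<n}"
  using assms unfolding pattern_def pattern_edges_def by fastforce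

lemma graph_iso_image_graph:
  assumes es: "pattern_edges n es" and xs: "distinct xs" "length xs = n"
  shows "graph_iso (pattern n es) (image_graph es xs)"
proof -
  have inj: "inj_on ((!) xs) {..<n}"
    using xs by (simp add: inj_on_nth)
  have bij: "bij_betw ((!) xs) (verts (pattern n es)) (verts (image_graph es xs))"
    using xs inj by (auto simp: bij_betw_def pattern_def image_graph_def set_conv_nth)
  have "{xs ! u, xs ! v} \<in> edges (image_graph es xs) \<longleftrightarrow> {u, v} \<in> edges (pattern n es)"
    if "u < n" "v < n" for u v
  proof -
    have injP: "inj_on ((`) ((!) xs)) (Pow {..<n})"
      using inj by (rule inj_on_image_Pow)
    have "{xs ! u, xs ! v} = (!) xs ` {u, v}" by simp
    moreover have "edges (pattern n es) \<subseteq> Pow {..<n}"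
      using Union_pattern_edges[OF es] by auto
    ultimately show ?thesis
      using inj_on_image_mem_iff[OF injP, of "{u, v}" "edges (pattern n es)"] that xs(2)
      by (simp add: image_graph_def)
  qed
  with bij show ?thesis
    unfolding graph_iso_def by (intro exI[of _ "(!) xs"]) (auto simp: pattern_def)
qed

lemma image_graph_in_subgraphs:
  assumes "pattern_edges n es" "xs \<in> embeddings n es G"
  shows "image_graph es xs \<in> subgraphs G"
proof -
  have "edges (image_graph es xs) \<subseteq> edges G"
    using assms(2) by (auto simp: edges_image_graph embeddings_def)
  moreover have "\<forall>e\<in>edges (image_graph es xs). e \<subseteq> set xs"
    using assms by (force simp: edges_image_graph embeddings_def pattern_edges_def)
  ultimately show ?thesis
    using assms(2) by (auto simp: subgraphs_def image_graph_def embeddings_def)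
qed

text \<open>Supplies the equality of edge numbers that later turns an inclusion of edge sets into an
  equality.\<close>

lemma bij_betw_edges:
  assumes fb: "bij_betw f (verts K) (verts H)"
    and fe: "\<And>u v. u \<in> verts K \<Longrightarrow> v \<in> verts K \<Longrightarrow> {u, v} \<in> edges K \<longleftrightarrow> {f u, f v} \<in> edges H"
    and K: "\<forall>e\<in>edges K. e \<subseteq> verts K \<and> card e = 2" and H: "\<forall>e\<in>edges H. e \<subseteq> verts H \<and> card e = 2"
  shows "bij_betw ((`) f) (edges K) (edges H)"
proof -
  have "inj_on ((`) f) (Pow (verts K))"
    using fb by (auto simp: bij_betw_def intro: inj_on_image_Pow)
  then have inj: "inj_on ((`) f) (edges K)"
    by (rule inj_on_subset) (use K in auto)
  have "f ` e \<in> edges H" if e: "e \<in> edges K" for e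
  proof -
    obtain u v where "e = {u, v}" using K e by (auto simp: card_2_iff)
    then show ?thesis using fe[of u v] K e by auto
  qed
  moreover have "e \<in> (`) f ` edges K" if e: "e \<in> edges H" for e
  proof -
    obtain a b where ab: "e = {a, b}" using H e by (auto simp: card_2_iff)
    then have "a \<in> verts H" "b \<in> verts H" using H e by auto
    then obtain u v where "u \<in> verts K" "v \<in> verts K" "a = f u" "b = f v"
      using fb unfolding bij_betw_def by (metis imageE)
    then have "{u, v} \<in> edges K" "e = f ` {u, v}" using fe[of u v] e ab by auto
    then show ?thesis by blast
  qed
  ultimately show ?thesis using inj by (auto simp: bij_betw_def)
qed

text \<open>Mapping along an isomorphism from the pattern to a given copy \<open>K\<close> identifies the embeddings with
  image \<open>K\<close> with the automorphisms of the pattern.\<close>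

lemma card_embeddings_fibre:
  assumes es: "pattern_edges n es" and G: "finite_simple_graph G"
    and K: "K \<in> subgraphs G" "graph_iso K (pattern n es)"
  shows "card {xs \<in> embeddings n es G. image_graph es xs = K} = card (embeddings n es (pattern n es))"
proof -
  let ?P = "pattern n es"
  have K2: "\<forall>e\<in>edges K. e \<subseteq> verts K \<and> card e = 2" and KG: "edges K \<subseteq> edges G" "verts K \<subseteq> verts G"
    using K(1) G unfolding subgraphs_def finite_simple_graph_def by fastforce+
  have P2: "\<forall>e\<in>edges ?P. e \<subseteq> verts ?P \<and> card e = 2"
    using es by (auto simp: pattern_def pattern_edges_def)
  obtain f where f: "bij_betw f (verts ?P) (verts K)"
    "\<forall>u\<in>verts ?P. \<forall>v\<in>verts ?P. {u, v} \<in> edges ?P \<longleftrightarrow> {f u, f v} \<in> edges K"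
    using graph_iso_sym[OF K(2)] unfolding graph_iso_def by blast
  have vP: "verts ?P = {..<n}" by (simp add: pattern_def)
  have inj: "inj_on f {..<n}" and im: "f ` {..<n} = verts K"
    using f(1) by (auto simp: bij_betw_def vP)
  have cardE: "card (edges ?P) = card (edges K)"
    using bij_betw_edges[OF f(1) _ P2 K2] f(2) by (auto intro: bij_betw_same_card)
  have finK: "finite (edges K)"
    using cardE bij_betw_edges[OF f(1) _ P2 K2] f(2) bij_betw_finite[of "(`) f" "edges ?P" "edges K"]
    by (auto simp: pattern_def)
  have fe: "{f u, f v} \<in> edges K \<longleftrightarrow> {u, v} \<in> edges ?P" if "u < n" "v < n" for u v
    using f(2) that by (auto simp: vP)
  have "bij_betw (map f) (embeddings n es ?P) {xs \<in> embeddings n es G. image_graph es xs = K}"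
    unfolding bij_betw_def
  proof (intro conjI subset_antisym subsetI)
    show "inj_on (map f) (embeddings n es ?P)"
      by (rule inj_on_subset[OF inj_on_map_lists[OF inj]]) (auto simp: embeddings_def vP)
  next
    fix xs assume "xs \<in> map f ` embeddings n es ?P"
    then obtain ys where ys: "xs = map f ys" "ys \<in> embeddings n es ?P" by blast
    then have ly: "length ys = n" "distinct ys" "set ys \<subseteq> {..<n}"
      and ye: "\<And>p q. (p, q) \<in> set es \<Longrightarrow> {ys ! p, ys ! q} \<in> edges ?P"
      by (auto simp: embeddings_def vP)
    have dx: "distinct xs" "length xs = n"
      using ys(1) ly inj by (auto simp: distinct_map intro: inj_on_subset)
    have sy: "set ys = {..<n}"
      using ly by (intro card_subset_eq) (auto simp: distinct_card)
    then have sx: "set xs = verts K" using ys(1) im by simp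
    have xe: "{xs ! p, xs ! q} \<in> edges K" if "(p, q) \<in> set es" for p q
    proof -
      have pq: "p < n" "q < n" using that es by (auto simp: pattern_edges_def)
      then have "ys ! p < n" "ys ! q < n" using ly(1) subsetD[OF ly(3) nth_mem] by auto
      then show ?thesis using fe ye[OF that] pq ys(1) ly by simp
    qed
    have sub: "edges (image_graph es xs) \<subseteq> edges K"
      using xe by (auto simp: edges_image_graph)
    \<comment> \<open>So far edges are only known to go into \<open>edges K\<close>; all of them are
      hit because both edge sets have the same finite size.\<close>
    have "card (edges (image_graph es xs)) = card (edges ?P)"
      using inj_on_image_edges[OF dx(1)] Union_pattern_edges[OF es] dx(2)
      by (auto simp: image_graph_def intro: card_image)
    then have "edges (image_graph es xs) = edges K"
      using sub cardE finK by (intro card_subset_eq) auto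
    then have "image_graph es xs = K"
      using sx by (auto simp: image_graph_def prod_eq_iff)
    moreover have "xs \<in> embeddings n es G"
      using dx sx KG xe by (auto simp: embeddings_def)
    ultimately show "xs \<in> {xs \<in> embeddings n es G. image_graph es xs = K}" by simp
  next
    fix xs assume "xs \<in> {xs \<in> embeddings n es G. image_graph es xs = K}"
    then have dx: "length xs = n" "distinct xs" and K': "image_graph es xs = K"
      by (auto simp: embeddings_def)
    then have sx: "set xs = verts K" by (auto simp: image_graph_def)
    let ?g = "the_inv_into {..<n} f"
    define ys where "ys = map ?g xs"
    have fg: "f (?g x) = x" "?g x < n" if "x \<in> verts K" for x
      using f_the_inv_into_f[OF inj] the_inv_into_into[OF inj] that im by auto
    have xy: "xs = map f ys"
      unfolding ys_def map_map using sx fg by (intro map_idI[symmetric]) auto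
    have sy: "set ys \<subseteq> {..<n}" unfolding ys_def using sx fg by auto
    have "distinct ys" using dx(2) xy by (simp add: distinct_map)
    moreover have "{ys ! p, ys ! q} \<in> edges ?P" if "(p, q) \<in> set es" for p q
    proof -
      have pq: "p < n" "q < n" using that es by (auto simp: pattern_edges_def)
      have "{xs ! p, xs ! q} \<in> edges K"
        using that K' by (auto simp: edges_image_graph)
      moreover have "length ys = n" using dx(1) by (simp add: ys_def)
      moreover have "ys ! p < n" "ys ! q < n" using pq calculation(2) subsetD[OF sy nth_mem] by auto
      ultimately show ?thesis using fe xy pq by simp
    qed
    ultimately have "ys \<in> embeddings n es ?P"
      using sy dx(1) by (auto simp: embeddings_def vP ys_def)
    then show "xs \<in> map f ` embeddings n es ?P" using xy by blast
  qed
  then show ?thesis by (simp add: bij_betw_same_card)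
qed

lemma finite_embeddings:
  assumes "finite (verts G)"
  shows "finite (embeddings n es G)"
  by (rule finite_subset[OF _ finite_lists_length_eq[OF assms, of n]]) (auto simp: embeddings_def)

lemma finite_subgraphs:
  assumes "finite_simple_graph G"
  shows "finite (subgraphs G)"
proof -
  have "finite (Pow (verts G) \<times> Pow (Pow (verts G)))"
    using assms by (simp add: finite_simple_graph_def)
  then show ?thesis
    by (rule rev_finite_subset) (unfold subgraphs_def, blast)
qed

text \<open>Double counting: grouping the embeddings by their image graph gives one fibre for each
  copy of \<open>F\<close>, and each fibre has as many members as the pattern has
  self-embeddings.\<close>

lemma card_embeddings:
  assumes G: "finite_simple_graph G" and es: "pattern_edges n es"
    and F: "F = image_graph es vs" "distinct vs" "length vs = n"
  shows "real (card (embeddings n es G)) = real (card (embeddings n es (pattern n es))) * count_sub F G"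
proof -
  let ?P = "pattern n es"
  let ?C = "{K \<in> subgraphs G. graph_iso K ?P}"
  have "graph_iso ?P F"
    using graph_iso_image_graph[OF es F(2,3)] F(1) by simp
  then have C: "{K \<in> subgraphs G. graph_iso K F} = ?C"
    using graph_iso_trans graph_iso_sym by blast
  have "image_graph es xs \<in> ?C" if "xs \<in> embeddings n es G" for xs
    using image_graph_in_subgraphs[OF es that] graph_iso_sym[OF graph_iso_image_graph[OF es, of xs]] that
    by (auto simp: embeddings_def)
  then have sub: "image_graph es ` embeddings n es G \<subseteq> ?C" by blast
  have "finite (embeddings n es G)" "finite ?C"
    using finite_subgraphs[OF G] finite_embeddings[of G n es] G by (auto simp: finite_simple_graph_def)
  from sum.group[OF this sub, of "\<lambda>_. 1::nat"]
  have "card (embeddings n es G) = (\<Sum>K\<in>?C. card {xs \<in> embeddings n es G. image_graph es xs = K})"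
    by simp
  also have "\<dots> = (\<Sum>K\<in>?C. card (embeddings n es ?P))"
    using card_embeddings_fibre[OF es G] by (intro sum.cong) auto
  finally show ?thesis by (simp add: count_sub_def C)
qed

section \<open>Enumeration of the automorphisms of a pattern\<close>

primrec arrangements :: "nat \<Rightarrow> 'a list \<Rightarrow> 'a list list" where
  "arrangements 0 zs = [[]]"
| "arrangements (Suc n) zs = concat (map (\<lambda>z. map ((#) z) (arrangements n (remove1 z zs))) zs)"

lemma set_arrangements:
  "distinct zs \<Longrightarrow> set (arrangements n zs) = {xs. length xs = n \<and> distinct xs \<and> set xs \<subseteq> set zs}"
proof (induction n arbitrary: zs)
  case (Suc n)
  show ?case
  proof (intro set_eqI iffI)
    fix xs assume "xs \<in> set (arrangements (Suc n) zs)"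
    then show "xs \<in> {xs. length xs = Suc n \<and> distinct xs \<and> set xs \<subseteq> set zs}"
      using Suc by (auto simp: set_remove1_eq)
  next
    fix xs assume "xs \<in> {xs. length xs = Suc n \<and> distinct xs \<and> set xs \<subseteq> set zs}"
    then obtain z ys where "xs = z # ys" "length ys = n" "z \<notin> set ys" "distinct ys" "z \<in> set zs" "set ys \<subseteq> set zs"
      by (auto simp: length_Suc_conv)
    then show "xs \<in> set (arrangements (Suc n) zs)"
      using Suc by (auto simp: set_remove1_eq)
  qed
qed auto

lemma arrangements_nonempty: "n \<le> length zs \<Longrightarrow> arrangements n zs \<noteq> []"
proof (induction n arbitrary: zs)
  case (Suc n)
  then obtain z where "z \<in> set zs" by (cases zs) auto
  with Suc show ?case by (auto simp: length_remove1)
qed simp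

text \<open>The block for each first entry \<open>z\<close> is nonempty, so different
  \<open>z\<close> give different blocks, and members of different blocks differ in their
  heads.\<close>

lemma distinct_arrangements:
  "distinct zs \<Longrightarrow> n \<le> length zs \<Longrightarrow> distinct (arrangements n zs)"
proof (induction n arbitrary: zs)
  case (Suc n)
  let ?f = "\<lambda>z. map ((#) z) (arrangements n (remove1 z zs))"
  have "inj_on ?f (set zs)"
  proof (rule inj_onI)
    fix y z assume "y \<in> set zs" "z \<in> set zs" "?f y = ?f z"
    moreover have "arrangements n (remove1 y zs) \<noteq> []"
      using Suc.prems calculation(1) by (intro arrangements_nonempty) (simp add: length_remove1)
    ultimately show "y = z" by (cases "arrangements n (remove1 y zs)"; cases "arrangements n (remove1 z zs)") auto
  qed
  moreover have "distinct (?f z)" if "z \<in> set zs" for z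
    using that Suc by (simp add: distinct_map length_remove1)
  ultimately show ?case
    using Suc.prems by (auto simp: distinct_map intro!: distinct_concat)
qed simp

text \<open>An executable form of the automorphism number: every self-embedding of a finite pattern
  is an automorphism. Both orientations are tested because \<open>es\<close> lists an edge in one
  direction only.\<close>

definition autos :: "nat \<Rightarrow> (nat \<times> nat) list \<Rightarrow> nat" where
  "autos n es = length (filter (\<lambda>xs. \<forall>(p, q)\<in>set es.
     (xs ! p, xs ! q) \<in> set es \<or> (xs ! q, xs ! p) \<in> set es) (arrangements n [0..<n]))"

lemma card_embeddings_pattern: "card (embeddings n es (pattern n es)) = autos n es"
proof -
  have "{u, v} \<in> edges (pattern n es) \<longleftrightarrow> (u, v) \<in> set es \<or> (v, u) \<in> set es" for u v
    by (force simp: pattern_def doubleton_eq_iff)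
  then have "embeddings n es (pattern n es) = set (filter (\<lambda>xs. \<forall>(p, q)\<in>set es.
     (xs ! p, xs ! q) \<in> set es \<or> (xs ! q, xs ! p) \<in> set es) (arrangements n [0..<n]))"
    unfolding embeddings_def set_filter set_arrangements[OF distinct_upt]
    by (simp add: pattern_def atLeast0LessThan conj_assoc)
  then show ?thesis
    by (simp only: autos_def distinct_card distinct_arrangements distinct_filter distinct_upt length_upt)
qed

section \<open>Sums over tuples of distinct vertices\<close>

text \<open>Distinctness is put into the ranges rather than the summand. Fixing the first variable
  thus leaves the operator with one variable less on \<open>V - {x}\<close>, which is how sums over
  neighbourhoods arise later.\<close>

definition dsum2 :: "'a set \<Rightarrow> ('a \<Rightarrow> 'a \<Rightarrow> real) \<Rightarrow> real" where
  "dsum2 V f = (\<Sum>x\<in>V. \<Sum>y\<in>V - {x}. f x y)"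

definition dsum3 :: "'a set \<Rightarrow> ('a \<Rightarrow> 'a \<Rightarrow> 'a \<Rightarrow> real) \<Rightarrow> real" where
  "dsum3 V f = (\<Sum>x\<in>V. dsum2 (V - {x}) (f x))"

definition dsum4 :: "'a set \<Rightarrow> ('a \<Rightarrow> 'a \<Rightarrow> 'a \<Rightarrow> 'a \<Rightarrow> real) \<Rightarrow> real" where
  "dsum4 V f = (\<Sum>x\<in>V. dsum3 (V - {x}) (f x))"

definition dsum5 :: "'a set \<Rightarrow> ('a \<Rightarrow> 'a \<Rightarrow> 'a \<Rightarrow> 'a \<Rightarrow> 'a \<Rightarrow> real) \<Rightarrow> real" where
  "dsum5 V f = (\<Sum>x\<in>V. dsum4 (V - {x}) (f x))"

lemma dsum2_cong:
  "(\<And>x y. x \<in> V \<Longrightarrow> y \<in> V \<Longrightarrow> x \<noteq> y \<Longrightarrow> f x y = g x y) \<Longrightarrow> dsum2 V f = dsum2 V g"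
  unfolding dsum2_def by (intro sum.cong refl) auto

lemma dsum3_cong:
  "(\<And>x y z. x \<in> V \<Longrightarrow> y \<in> V \<Longrightarrow> z \<in> V \<Longrightarrow> x \<noteq> y \<Longrightarrow> x \<noteq> z \<Longrightarrow> y \<noteq> z \<Longrightarrow> f x y z = g x y z)
   \<Longrightarrow> dsum3 V f = dsum3 V g"
  unfolding dsum3_def by (intro sum.cong refl dsum2_cong) auto

lemma dsum4_cong:
  "(\<And>x y z w. x \<in> V \<Longrightarrow> y \<in> V \<Longrightarrow> z \<in> V \<Longrightarrow> w \<in> V \<Longrightarrow> x \<noteq> y \<Longrightarrow> x \<noteq> z \<Longrightarrow> x \<noteq> w \<Longrightarrow>
     y \<noteq> z \<Longrightarrow> y \<noteq> w \<Longrightarrow> z \<noteq> w \<Longrightarrow> f x y z w = g x y z w) \<Longrightarrow> dsum4 V f = dsum4 V g"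
  unfolding dsum4_def by (intro sum.cong refl dsum3_cong) auto

lemma dsum2_diff: "dsum2 V (\<lambda>x y. f x y - g x y) = dsum2 V f - dsum2 V g"
  by (simp add: dsum2_def sum_subtractf)

lemma dsum3_diff: "dsum3 V (\<lambda>x y z. f x y z - g x y z) = dsum3 V f - dsum3 V g"
  by (simp add: dsum3_def dsum2_diff sum_subtractf)

lemma dsum4_diff: "dsum4 V (\<lambda>x y z w. f x y z w - g x y z w) = dsum4 V f - dsum4 V g"
  by (simp add: dsum4_def dsum3_diff sum_subtractf)

lemma dsum2_scale: "dsum2 V (\<lambda>x y. c * f x y) = c * dsum2 V f"
  by (simp add: dsum2_def sum_distrib_left)

lemma dsum3_scale: "dsum3 V (\<lambda>x y z. c * f x y z) = c * dsum3 V f"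
  by (simp add: dsum3_def dsum2_scale sum_distrib_left)

text \<open>The operators are built from the first variable, but reductions remove the last one. The
  versions for more variables follow from the previous one on \<open>V - {x}\<close>; the term at
  \<open>x\<close>, absent from that range, is subtracted by \<open>sum_diff1\<close>.\<close>

lemma dsum2_last:
  assumes "finite V"
  shows "dsum2 V f = (\<Sum>x\<in>V. (\<Sum>v\<in>V. f x v) - f x x)"
  unfolding dsum2_def using assms by (intro sum.cong refl) (simp add: sum_diff1)

lemma dsum3_last:
  assumes "finite V"
  shows "dsum3 V f = dsum2 V (\<lambda>x y. (\<Sum>v\<in>V. f x y v) - f x y x - f x y y)"
  unfolding dsum3_def dsum2_def[of V] using assms
  by (intro sum.cong refl) (auto simp: dsum2_last sum_diff1 intro!: sum.cong)

lemma dsum4_last: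
  assumes "finite V"
  shows "dsum4 V f = dsum3 V (\<lambda>x y z. (\<Sum>v\<in>V. f x y z v) - f x y z x - f x y z y - f x y z z)"
  unfolding dsum4_def dsum3_def[of V] using assms
  by (intro sum.cong refl) (auto simp: dsum3_last sum_diff1 intro!: dsum2_cong)

lemma dsum5_last:
  assumes "finite V"
  shows "dsum5 V f = dsum4 V (\<lambda>x y z w. (\<Sum>v\<in>V. f x y z w v) - f x y z w x - f x y z w y
    - f x y z w z - f x y z w w)"
  unfolding dsum5_def dsum4_def[of V] using assms
  by (intro sum.cong refl) (auto simp: dsum4_last sum_diff1 intro!: dsum3_cong)

lemma dsum2_swap:
  assumes "finite V"
  shows "dsum2 V f = dsum2 V (\<lambda>x y. f y x)"
  unfolding dsum2_last[OF assms] sum_subtractf by (subst sum.swap) simp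

lemma sum_distinct_lists_Suc:
  assumes "finite V"
  shows "(\<Sum>xs\<in>{xs. length xs = Suc n \<and> distinct xs \<and> set xs \<subseteq> V}. h xs) =
    (\<Sum>x\<in>V. \<Sum>xs\<in>{xs. length xs = n \<and> distinct xs \<and> set xs \<subseteq> V - {x}}. h (x # xs) :: real)"
proof -
  let ?A = "\<lambda>n V. {xs :: 'a list. length xs = n \<and> distinct xs \<and> set xs \<subseteq> V}"
  have fin: "finite (?A n W)" if "finite W" for n W
    by (rule finite_subset[OF _ finite_lists_length_eq[OF that, of n]]) auto
  have "(\<Sum>x\<in>V. \<Sum>xs\<in>?A n (V - {x}). h (x # xs)) =
      (\<Sum>(x, xs)\<in>(SIGMA x:V. ?A n (V - {x})). h (x # xs))"
    using assms fin by (intro sum.Sigma) auto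
  also have "\<dots> = sum h (?A (Suc n) V)"
    by (rule sum.reindex_bij_witness[of _ "\<lambda>xs. (hd xs, tl xs)" "\<lambda>(x, xs). x # xs"])
      (auto simp: length_Suc_conv)
  finally show ?thesis by simp
qed

text \<open>The list \<open>vs\<close> names the vertices of \<open>F\<close> in the order of the summation variables, and \<open>es\<close> lists the
  edges of \<open>F\<close> as pairs of positions in \<open>vs\<close>; \<open>c\<close> is the number of automorphisms of \<open>F\<close>.\<close>

definition labelling :: "nat graph \<Rightarrow> nat list \<Rightarrow> (nat \<times> nat) list \<Rightarrow> nat \<Rightarrow> bool" where
  "labelling F vs es c \<longleftrightarrow> distinct vs \<and> pattern_edges (length vs) es \<and> F = image_graph es vs \<and>
     autos (length vs) es = c"

lemma dsum_distinct_lists: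
  assumes "finite V"
  shows "(\<Sum>xs\<in>{xs. length xs = 3 \<and> distinct xs \<and> set xs \<subseteq> V}. h xs) = dsum3 V (\<lambda>x y z. h [x, y, z])"
    and "(\<Sum>xs\<in>{xs. length xs = 4 \<and> distinct xs \<and> set xs \<subseteq> V}. h xs) = dsum4 V (\<lambda>x y z w. h [x, y, z, w])"
    and "(\<Sum>xs\<in>{xs. length xs = 5 \<and> distinct xs \<and> set xs \<subseteq> V}. h xs) =
      dsum5 V (\<lambda>x y z w v. h [x, y, z, w, v])"
proof -
  \<comment> \<open>Lengths are spelled with \<open>Suc\<close> so that the head-tail recursion
    applies; numerals return at the end.\<close>
  have 2: "(\<Sum>xs\<in>{xs. length xs = Suc (Suc 0) \<and> distinct xs \<and> set xs \<subseteq> V}. h xs) = dsum2 V (\<lambda>x y. h [x, y])"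
    if "finite V" for V and h :: "'a list \<Rightarrow> real"
    using that by (simp add: sum_distinct_lists_Suc dsum2_def cong: conj_cong)
  have 3: "(\<Sum>xs\<in>{xs. length xs = Suc (Suc (Suc 0)) \<and> distinct xs \<and> set xs \<subseteq> V}. h xs) =
      dsum3 V (\<lambda>x y z. h [x, y, z])"
    if "finite V" for V and h :: "'a list \<Rightarrow> real"
    using that by (simp add: sum_distinct_lists_Suc[where n = "Suc (Suc 0)"] 2 dsum3_def)
  have 4: "(\<Sum>xs\<in>{xs. length xs = Suc (Suc (Suc (Suc 0))) \<and> distinct xs \<and> set xs \<subseteq> V}. h xs) =
      dsum4 V (\<lambda>x y z w. h [x, y, z, w])"
    if "finite V" for V and h :: "'a list \<Rightarrow> real"
    using that by (simp add: sum_distinct_lists_Suc[where n = "Suc (Suc (Suc 0))"] 3 dsum4_def)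
  have 5: "(\<Sum>xs\<in>{xs. length xs = Suc (Suc (Suc (Suc (Suc 0)))) \<and> distinct xs \<and> set xs \<subseteq> V}. h xs) =
      dsum5 V (\<lambda>x y z w v. h [x, y, z, w, v])"
    if "finite V" for V and h :: "'a list \<Rightarrow> real"
    using that by (simp add: sum_distinct_lists_Suc[where n = "Suc (Suc (Suc (Suc 0)))"] 4 dsum5_def)
  show "(\<Sum>xs\<in>{xs. length xs = 3 \<and> distinct xs \<and> set xs \<subseteq> V}. h xs) = dsum3 V (\<lambda>x y z. h [x, y, z])"
    "(\<Sum>xs\<in>{xs. length xs = 4 \<and> distinct xs \<and> set xs \<subseteq> V}. h xs) = dsum4 V (\<lambda>x y z w. h [x, y, z, w])"
    "(\<Sum>xs\<in>{xs. length xs = 5 \<and> distinct xs \<and> set xs \<subseteq> V}. h xs) =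
      dsum5 V (\<lambda>x y z w v. h [x, y, z, w, v])"
    using 3[OF assms] 4[OF assms] 5[OF assms] by (simp_all add: numeral_eq_Suc)
qed

section \<open>Adjacency sums of a simple graph\<close>

locale simple_graph =
  fixes G :: "'a graph"
  assumes simple: "finite_simple_graph G"
begin

abbreviation "V \<equiv> verts G"
abbreviation "a \<equiv> adj G"
abbreviation "k \<equiv> deg G"
abbreviation "g2 \<equiv> adj_pow G 2"
abbreviation "g3 \<equiv> adj_pow G 3"

lemma finV [simp, intro]: "finite V"
  using simple by (simp add: finite_simple_graph_def)

lemma a_self [simp]: "a x x = 0"
  using simple by (auto simp: adj_def finite_simple_graph_def)

lemma a_commute: "a x y = a y x"
  by (simp add: adj_def insert_commute)

lemma a_cases: "a x y = 0 \<or> a x y = 1"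
  by (simp add: adj_def)

lemma a_outside: "x \<notin> V \<or> y \<notin> V \<Longrightarrow> a x y = 0"
  using simple by (auto simp: adj_def finite_simple_graph_def)

text \<open>A product of 0-1 entries is the indicator that all listed pairs are edges, so the sum is
  the number of embeddings.\<close>

lemma sum_embeddings:
  assumes "labelling F vs es c"
  shows "(\<Sum>xs\<in>{xs. length xs = length vs \<and> distinct xs \<and> set xs \<subseteq> V}.
    \<Prod>(p, q)\<leftarrow>es. a (xs ! p) (xs ! q)) = real c * count_sub F G"
proof -
  let ?A = "{xs. length xs = length vs \<and> distinct xs \<and> set xs \<subseteq> V}"
  have "(\<Prod>(p, q)\<leftarrow>es. a (xs ! p) (xs ! q)) = (if \<forall>(p, q)\<in>set es. {xs ! p, xs ! q} \<in> edges G then 1 else 0)" for xs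
    by (induction es) (auto simp: adj_def)
  then have "(\<Sum>xs\<in>?A. \<Prod>(p, q)\<leftarrow>es. a (xs ! p) (xs ! q)) =
      (\<Sum>xs\<in>?A. if \<forall>(p, q)\<in>set es. {xs ! p, xs ! q} \<in> edges G then 1 else 0)"
    by simp
  also have "\<dots> = real (card (embeddings (length vs) es G))"
  proof -
    have "finite ?A"
      by (rule finite_subset[OF _ finite_lists_length_eq[OF finV, of "length vs"]]) auto
    moreover have "embeddings (length vs) es G = {xs \<in> ?A. \<forall>(p, q)\<in>set es. {xs ! p, xs ! q} \<in> edges G}"
      by (auto simp: embeddings_def)
    ultimately show ?thesis by (simp add: sum.inter_filter[symmetric])
  qed
  also have "\<dots> = real c * count_sub F G"
    using card_embeddings[OF simple, of "length vs" es F vs] assms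
    by (auto simp: labelling_def card_embeddings_pattern)
  finally show ?thesis .
qed

text \<open>This lemma and the next two are the interface to the counting part. For a concrete
  graphlet the first premise is settled by evaluation; the last one replaces the list product by a
  summand grouped for later summation.\<close>

lemma dsum3_countI:
  assumes "labelling F vs es n" "length vs = 3" "c = real n"
    and "\<And>x y z. (\<Prod>(p, q)\<leftarrow>es. a ([x, y, z] ! p) ([x, y, z] ! q)) = f x y z"
  shows "dsum3 V f = c * count_sub F G"
  using sum_embeddings[OF assms(1)] assms(2-) by (simp add: dsum_distinct_lists)

lemma dsum4_countI:
  assumes "labelling F vs es n" "length vs = 4" "c = real n"
    and "\<And>x y z w. (\<Prod>(p, q)\<leftarrow>es. a ([x, y, z, w] ! p) ([x, y, z, w] ! q)) = f x y z w"
  shows "dsum4 V f = c * count_sub F G"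
  using sum_embeddings[OF assms(1)] assms(2-) by (simp add: dsum_distinct_lists)

lemma dsum5_countI:
  assumes "labelling F vs es n" "length vs = 5" "c = real n"
    and "\<And>x y z w v. (\<Prod>(p, q)\<leftarrow>es. a ([x, y, z, w, v] ! p) ([x, y, z, w, v] ! q)) = f x y z w v"
  shows "dsum5 V f = c * count_sub F G"
  using sum_embeddings[OF assms(1)] assms(2-) by (simp add: dsum_distinct_lists)

section \<open>Degrees and entries of powers as sums over one vertex\<close>

lemma sum_a: "(\<Sum>v\<in>V. a x v) = k x"
  by (simp add: deg_def)

text \<open>The zeroth power has ones on the diagonal outside \<open>V\<close> as well. For such
  \<open>x\<close> the sum over \<open>V\<close> is 0, which agrees with \<open>a\<close> because
  edges lie inside \<open>V\<close>.\<close>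

lemma adj_pow_1: "adj_pow G (Suc 0) x y = a x y"
proof (cases "x \<in> V")
  case True
  then show ?thesis
    by (simp add: adj_pow_def mat_mult_def sum.delta if_distrib[of "\<lambda>c. c * _"] cong: if_cong)
next
  case False
  then show ?thesis
    by (auto simp: adj_pow_def mat_mult_def a_outside intro!: sum.neutral)
qed

lemma adj_pow_Suc: "adj_pow G (Suc r) x y = (\<Sum>v\<in>V. adj_pow G r x v * a v y)"
  by (simp add: adj_pow_def mat_mult_def)

lemma sum_aa: "(\<Sum>v\<in>V. a x v * a v y) = g2 x y"
  using adj_pow_Suc[of 1 x y] by (simp add: adj_pow_1 numeral_2_eq_2)

lemma g2_commute: "g2 x y = g2 y x"
  by (simp add: sum_aa[symmetric] a_commute mult.commute)

lemma g2_self: "g2 x x = k x"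
  using a_cases by (auto simp: sum_aa[symmetric] sum_a[symmetric] a_commute[of _ x] intro!: sum.cong)

text \<open>Reassociation turns two multiplications by \<open>a\<close> into one by
  \<open>g2\<close>, so the powers up to the fifth become the convolutions that appear once vertices
  have been summed out.\<close>

lemma adj_pow_add2: "adj_pow G (Suc (Suc r)) x y = (\<Sum>v\<in>V. adj_pow G r x v * g2 v y)"
proof -
  have "adj_pow G (Suc (Suc r)) x y = (\<Sum>v\<in>V. \<Sum>u\<in>V. adj_pow G r x u * (a u v * a v y))"
    by (simp add: adj_pow_Suc sum_distrib_right mult.assoc)
  also have "\<dots> = (\<Sum>u\<in>V. adj_pow G r x u * g2 u y)"
    by (subst sum.swap) (simp add: sum_aa[symmetric] sum_distrib_left)
  finally show ?thesis .
qed

lemma sum_ag2: "(\<Sum>v\<in>V. a x v * g2 v y) = g3 x y"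
  using adj_pow_add2[of 1 x y] by (simp add: adj_pow_1 numeral_3_eq_3)

lemma sum_ag2': "(\<Sum>v\<in>V. a x v * g2 y v) = g3 x y"
  by (subst g2_commute) (rule sum_ag2)

lemma sum_g2g2: "(\<Sum>v\<in>V. g2 x v * g2 v y) = adj_pow G 4 x y"
  using adj_pow_add2[of 2 x y] by (simp add: numeral_eq_Suc)

lemma sum_g3g2: "(\<Sum>v\<in>V. g3 x v * g2 v y) = adj_pow G 5 x y"
  using adj_pow_add2[of 3 x y] by (simp add: numeral_eq_Suc)

text \<open>In the next four lemmas the correction terms of \<open>f\<close> are the coincidences of the last variable with an
  earlier one. The premises make every pointwise goal decidable by splitting on the entries
  of the adjacency matrix.\<close>

lemma dsum5_reduce:
  assumes "\<And>x y z w. \<lbrakk>a x y = 0 \<or> a x y = 1; a x z = 0 \<or> a x z = 1; a x w = 0 \<or> a x w = 1;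
    a y z = 0 \<or> a y z = 1; a y w = 0 \<or> a y w = 1; a z w = 0 \<or> a z w = 1;
    a y x = a x y; a z x = a x z; a w x = a x w; a z y = a y z; a w y = a y w; a w z = a z w\<rbrakk> \<Longrightarrow>
    (\<Sum>v\<in>V. f x y z w v) = f x y z w x + f x y z w y + f x y z w z + f x y z w w + g x y z w"
  shows "dsum5 V f = dsum4 V g"
  unfolding dsum5_last[OF finV]
  by (rule dsum4_cong, subst assms) (simp_all add: a_cases a_commute)

lemma dsum4_reduce:
  assumes "\<And>x y z. \<lbrakk>a x y = 0 \<or> a x y = 1; a x z = 0 \<or> a x z = 1; a y z = 0 \<or> a y z = 1;
    a y x = a x y; a z x = a x z; a z y = a y z\<rbrakk> \<Longrightarrow>
    (\<Sum>v\<in>V. f x y z v) = f x y z x + f x y z y + f x y z z + g x y z"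
  shows "dsum4 V f = dsum3 V g"
  unfolding dsum4_last[OF finV]
  by (rule dsum3_cong, subst assms) (simp_all add: a_cases a_commute)

lemma dsum3_reduce:
  assumes "\<And>x y. \<lbrakk>a x y = 0 \<or> a x y = 1; a y x = a x y\<rbrakk> \<Longrightarrow>
    (\<Sum>v\<in>V. f x y v) = f x y x + f x y y + g x y"
  shows "dsum3 V f = dsum2 V g"
  unfolding dsum3_last[OF finV]
  by (rule dsum2_cong, subst assms) (simp_all add: a_cases a_commute)

lemma dsum2_reduce:
  assumes "\<And>x. (\<Sum>v\<in>V. f x v) = f x x + g x"
  shows "dsum2 V f = (\<Sum>x\<in>V. g x)"
  unfolding dsum2_last[OF finV] by (simp add: assms)

text \<open>For unfolding: constant factors leave the sum over the removed vertex, and the rest is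
  folded into a degree or an entry of a power.\<close>

lemmas sum_out = sum_distrib_left[symmetric] sum_distrib_right[symmetric] sum_a sum_aa sum_ag2 sum_ag2' sum_g2g2

section \<open>Graphlet counts as sums over distinct vertices\<close>

lemma triangle_count:
  "dsum3 V (\<lambda>i j r. a i j * (a i r * a r j)) = 6 * count_sub M7 G"
    \<comment> \<open>Here and below \<open>code_simp\<close> evaluates \<open>labelling\<close>,
      including the automorphism number; the list of labels is ordered to fit the variables of the
      summand.\<close>
    by (rule dsum3_countI[of M7 "[1, 2, 3]" "[(0, 1), (0, 2), (2, 1)]" 6]) (code_simp, simp_all)

text \<open>\<open>g3 i i\<close> counts each triangle at \<open>i\<close> in both directions, as do
  the ordered choices of \<open>j\<close> and \<open>r\<close>. The weight \<open>c\<close> makes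
  room for degree factors.\<close>

lemma triangle_sum:
  "dsum3 V (\<lambda>i j r. a i j * (a i r * a r j) * c i) = (\<Sum>i\<in>V. g3 i i * c i)"
proof -
  have "dsum3 V (\<lambda>i j r. a i j * (a i r * a r j) * c i) = dsum2 V (\<lambda>i j. a i j * g2 i j * c i)"
    by (rule dsum3_reduce) (unfold sum_out, elim disjE; simp add: algebra_simps)
  also have "\<dots> = (\<Sum>i\<in>V. g3 i i * c i)"
    by (rule dsum2_reduce) (unfold sum_out, simp add: algebra_simps)
  finally show ?thesis .
qed

lemma M13_count:
  "dsum4 V (\<lambda>x y z w. a x y * a x z * a y w) = 2 * count_sub M13 G"
    by (rule dsum4_countI[of M13 "[3, 4, 2, 1]" "[(0, 1), (0, 2), (1, 3)]" 2]) (code_simp, simp_all)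

lemma M15_count:
  "dsum4 V (\<lambda>x y z w. a x y * (a x z * a z y) * a x w) = 2 * count_sub M15 G"
    by (rule dsum4_countI[of M15 "[4, 2, 3, 1]" "[(0, 1), (0, 2), (2, 1), (0, 3)]" 2]) (code_simp, simp_all)

lemma M30_count:
  "dsum4 V (\<lambda>x y z w. (a x z * a z y) * (a x w * a w y)) = 8 * count_sub M30 G"
    by (rule dsum4_countI[of M30 "[1, 2, 3, 4]" "[(0, 2), (2, 1), (0, 3), (3, 1)]" 8]) (code_simp, simp_all)

lemma M31_count:
  "dsum4 V (\<lambda>x y z w. a x y * (a x z * a z y) * (a x w * a w y)) = 4 * count_sub M31 G"
    by (rule dsum4_countI[of M31 "[3, 4, 1, 2]" "[(0, 1), (0, 2), (2, 1), (0, 3), (3, 1)]" 4]) (code_simp, simp_all)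

lemma M63_count:
  "dsum4 V (\<lambda>x y z w. (a x y * a x z * a x w) * (a y z * (a y w * a w z))) = 24 * count_sub M63 G"
    by (rule dsum4_countI[of M63 "[1, 2, 3, 4]" "[(0, 1), (0, 2), (0, 3), (1, 2), (1, 3), (3, 2)]" 24]) (code_simp, simp_all)

text \<open>A neighbour of \<open>i\<close> is \<open>j\<close>, \<open>r\<close> or a fourth
  vertex. The two coincidences give twice the 6 labelled triangles, hence 12; the fourth vertex is
  the pendant of a paw.\<close>

lemma triangle_deg_fst:
  "dsum3 V (\<lambda>i j r. a i j * (a i r * a r j) * k i) = 2 * count_sub M15 G + 12 * count_sub M7 G"
proof -
  have E: "dsum4 V (\<lambda>i j r m. a i j * (a i r * a r j) * a i m) = dsum3 V (\<lambda>i j r. a i j * (a i r * a r j) * k i) - dsum3 V (\<lambda>i j r. 2 * (a i j * (a i r * a r j)))"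
    by (unfold dsum3_diff[symmetric], rule dsum4_reduce, unfold sum_out, elim disjE; simp add: algebra_simps)
  show ?thesis using M15_count E triangle_count by (simp add: dsum3_scale)
qed

text \<open>Equal to the previous sum by symmetry, but derived directly so that no variables have to
  be permuted.\<close>

lemma triangle_deg_snd:
  "dsum3 V (\<lambda>i j r. a i j * (a i r * a r j) * k j) = 2 * count_sub M15 G + 12 * count_sub M7 G"
proof -
  have P: "dsum4 V (\<lambda>i j r m. a i j * (a i r * a r j) * a j m) = 2 * count_sub M15 G"
    by (rule dsum4_countI[of M15 "[2, 4, 3, 1]" "[(0, 1), (0, 2), (2, 1), (1, 3)]" 2]) (code_simp, simp_all)
  have E: "dsum4 V (\<lambda>i j r m. a i j * (a i r * a r j) * a j m) = dsum3 V (\<lambda>i j r. a i j * (a i r * a r j) * k j) - dsum3 V (\<lambda>i j r. 2 * (a i j * (a i r * a r j)))"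
    by (unfold dsum3_diff[symmetric], rule dsum4_reduce, unfold sum_out, elim disjE; simp add: algebra_simps)
  show ?thesis using P E triangle_count by (simp add: dsum3_scale)
qed

text \<open>A common neighbour of \<open>i\<close> and \<open>j\<close> is \<open>r\<close>, which
  gives the triangle back, or the fourth vertex of a diamond. The next two lemmas do the same for
  the other two edges of the triangle.\<close>

lemma triangle_g2_fst_snd:
  "dsum3 V (\<lambda>i j r. a i j * (a i r * a r j) * g2 i j) = 4 * count_sub M31 G + 6 * count_sub M7 G"
proof -
  have P: "dsum4 V (\<lambda>i j r m. a i j * (a i r * a r j) * (a i m * a m j)) = 4 * count_sub M31 G"
    by (rule dsum4_countI[of M31 "[3, 4, 1, 2]" "[(0, 1), (0, 2), (2, 1), (0, 3), (3, 1)]" 4]) (code_simp, simp_all)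
  have E: "dsum4 V (\<lambda>i j r m. a i j * (a i r * a r j) * (a i m * a m j)) = dsum3 V (\<lambda>i j r. a i j * (a i r * a r j) * g2 i j) - dsum3 V (\<lambda>i j r. a i j * (a i r * a r j))"
    by (unfold dsum3_diff[symmetric], rule dsum4_reduce, unfold sum_out, elim disjE; simp add: algebra_simps)
  show ?thesis using P E triangle_count by simp
qed

lemma triangle_g2_fst_thd:
  "dsum3 V (\<lambda>i j r. a i j * (a i r * a r j) * g2 i r) = 4 * count_sub M31 G + 6 * count_sub M7 G"
proof -
  have P: "dsum4 V (\<lambda>i j r m. a i j * (a i r * a r j) * (a i m * a m r)) = 4 * count_sub M31 G"
    by (rule dsum4_countI[of M31 "[3, 1, 4, 2]" "[(0, 1), (0, 2), (2, 1), (0, 3), (3, 2)]" 4]) (code_simp, simp_all)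
  have E: "dsum4 V (\<lambda>i j r m. a i j * (a i r * a r j) * (a i m * a m r)) = dsum3 V (\<lambda>i j r. a i j * (a i r * a r j) * g2 i r) - dsum3 V (\<lambda>i j r. a i j * (a i r * a r j))"
    by (unfold dsum3_diff[symmetric], rule dsum4_reduce, unfold sum_out, elim disjE; simp add: algebra_simps)
  show ?thesis using P E triangle_count by simp
qed

lemma triangle_g2_thd_snd:
  "dsum3 V (\<lambda>i j r. a i j * (a i r * a r j) * g2 r j) = 4 * count_sub M31 G + 6 * count_sub M7 G"
proof -
  have P: "dsum4 V (\<lambda>i j r m. a i j * (a i r * a r j) * (a r m * a m j)) = 4 * count_sub M31 G"
    by (rule dsum4_countI[of M31 "[1, 3, 4, 2]" "[(0, 1), (0, 2), (2, 1), (2, 3), (3, 1)]" 4]) (code_simp, simp_all)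
  have E: "dsum4 V (\<lambda>i j r m. a i j * (a i r * a r j) * (a r m * a m j)) = dsum3 V (\<lambda>i j r. a i j * (a i r * a r j) * g2 r j) - dsum3 V (\<lambda>i j r. a i j * (a i r * a r j))"
    by (unfold dsum3_diff[symmetric], rule dsum4_reduce, unfold sum_out, elim disjE; simp add: algebra_simps)
  show ?thesis using P E triangle_count by simp
qed

text \<open>The middle edge of the path joins \<open>i\<close> and \<open>j\<close>. If the two ends
  coincide they close a triangle, which is the correction.\<close>

lemma M13_dsum:
  "2 * count_sub M13 G = dsum2 V (\<lambda>i j. a i j * ((k i - 1) * (k j - 1))) - 6 * count_sub M7 G"
proof -
  have E1: "dsum4 V (\<lambda>i j m n. a i j * a i m * a j n) = dsum3 V (\<lambda>i j m. a i j * a i m * (k j - 1)) - dsum3 V (\<lambda>i j m. a i j * (a i m * a m j))"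
    by (unfold dsum3_diff[symmetric], rule dsum4_reduce, unfold sum_out, elim disjE; simp add: algebra_simps)
  have E2: "dsum3 V (\<lambda>i j m. a i j * a i m * (k j - 1)) = dsum2 V (\<lambda>i j. a i j * ((k i - 1) * (k j - 1)))"
    by (rule dsum3_reduce) (unfold sum_out, elim disjE; simp add: algebra_simps)
  show ?thesis using M13_count E1 E2 triangle_count by simp
qed

lemma M15_sum:
  "2 * count_sub M15 G = (\<Sum>i\<in>V. g3 i i * (k i - 2))"
proof -
  have E: "dsum4 V (\<lambda>i j r m. a i j * (a i r * a r j) * a i m) = dsum3 V (\<lambda>i j r. a i j * (a i r * a r j) * (k i - 2))"
    by (rule dsum4_reduce) (unfold sum_out, elim disjE; simp add: algebra_simps)
  show ?thesis using M15_count E triangle_sum[of "\<lambda>i. k i - 2"] by simp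
qed

lemma M30_dsum:
  "8 * count_sub M30 G = dsum2 V (\<lambda>i j. g2 i j * (g2 i j - 1))"
proof -
  have E1: "dsum4 V (\<lambda>i j u v. (a i u * a u j) * (a i v * a v j)) = dsum3 V (\<lambda>i j u. (a i u * a u j) * (g2 i j - 1))"
    by (rule dsum4_reduce) (unfold sum_out, elim disjE; simp add: algebra_simps)
  have E2: "dsum3 V (\<lambda>i j u. (a i u * a u j) * (g2 i j - 1)) = dsum2 V (\<lambda>i j. g2 i j * (g2 i j - 1))"
    by (rule dsum3_reduce) (unfold sum_out, elim disjE; simp add: algebra_simps)
  show ?thesis using M30_count E1 E2 by simp
qed

lemma M31_dsum:
  "4 * count_sub M31 G = dsum2 V (\<lambda>i j. a i j * (g2 i j * (g2 i j - 1)))"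
proof -
  have E1: "dsum4 V (\<lambda>i j u v. a i j * (a i u * a u j) * (a i v * a v j)) = dsum3 V (\<lambda>i j u. a i j * (a i u * a u j) * (g2 i j - 1))"
    by (rule dsum4_reduce) (unfold sum_out, elim disjE; simp add: algebra_simps)
  have E2: "dsum3 V (\<lambda>i j u. a i j * (a i u * a u j) * (g2 i j - 1)) = dsum2 V (\<lambda>i j. a i j * (g2 i j * (g2 i j - 1)))"
    by (rule dsum3_reduce) (unfold sum_out, elim disjE; simp add: algebra_simps)
  show ?thesis using M31_count E1 E2 by simp
qed

lemma M3_dsum:
  "2 * count_sub M3 G = dsum2 V g2"
proof -
  have P: "dsum3 V (\<lambda>i j u. a i u * a u j) = 2 * count_sub M3 G"
    by (rule dsum3_countI[of M3 "[1, 2, 3]" "[(0, 2), (2, 1)]" 2]) (code_simp, simp_all)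
  have E: "dsum3 V (\<lambda>i j u. a i u * a u j) = dsum2 V g2"
    by (rule dsum3_reduce) (unfold sum_out, elim disjE; simp add: algebra_simps)
  show ?thesis using P E by simp
qed

text \<open>Counts by the centre, where \<open>M3_dsum\<close> counts by the two ends; the trace
  formula for the 4-cycle needs both.\<close>

lemma M3_sum:
  "2 * count_sub M3 G = (\<Sum>i\<in>V. k i * (k i - 1))"
proof -
  have P: "dsum3 V (\<lambda>i j u. a i j * a i u) = 2 * count_sub M3 G"
    by (rule dsum3_countI[of M3 "[3, 1, 2]" "[(0, 1), (0, 2)]" 2]) (code_simp, simp_all)
  have E1: "dsum3 V (\<lambda>i j u. a i j * a i u) = dsum2 V (\<lambda>i j. a i j * (k i - 1))"
    by (rule dsum3_reduce) (unfold sum_out, elim disjE; simp add: algebra_simps)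
  have E2: "dsum2 V (\<lambda>i j. a i j * (k i - 1)) = (\<Sum>i\<in>V. k i * (k i - 1))"
    by (rule dsum2_reduce) (unfold sum_out, simp add: algebra_simps)
  show ?thesis using P E1 E2 by simp
qed

section \<open>Graphlets on five vertices\<close>

lemma M75_sum:
  "24 * count_sub M75 G = (\<Sum>i\<in>V. k i * (k i - 1) * (k i - 2) * (k i - 3))"
proof -
  have P: "dsum5 V (\<lambda>i p q r s. a i p * a i q * a i r * a i s) = 24 * count_sub M75 G"
    by (rule dsum5_countI[of M75 "[5, 1, 2, 3, 4]" "[(0, 1), (0, 2), (0, 3), (0, 4)]" 24]) (code_simp, simp_all)
  have E1: "dsum5 V (\<lambda>i p q r s. a i p * a i q * a i r * a i s) = dsum4 V (\<lambda>i p q r. a i p * a i q * a i r * (k i - 3))"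
    by (rule dsum5_reduce) (unfold sum_out, elim disjE; simp add: algebra_simps)
  have E2: "dsum4 V (\<lambda>i p q r. a i p * a i q * a i r * (k i - 3)) = dsum3 V (\<lambda>i p q. a i p * a i q * ((k i - 2) * (k i - 3)))"
    by (rule dsum4_reduce) (unfold sum_out, elim disjE; simp add: algebra_simps)
  have E3: "dsum3 V (\<lambda>i p q. a i p * a i q * ((k i - 2) * (k i - 3))) = dsum2 V (\<lambda>i p. a i p * ((k i - 1) * (k i - 2) * (k i - 3)))"
    by (rule dsum3_reduce) (unfold sum_out, elim disjE; simp add: algebra_simps)
  have E4: "dsum2 V (\<lambda>i p. a i p * ((k i - 1) * (k i - 2) * (k i - 3))) = (\<Sum>i\<in>V. k i * (k i - 1) * (k i - 2) * (k i - 3))"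
    by (rule dsum2_reduce) (unfold sum_out, simp add: algebra_simps)
  show ?thesis using P E1 E2 E3 E4 by simp
qed

text \<open>The centre \<open>i\<close> has leaves \<open>m\<close>, \<open>n\<close> and the long
  branch \<open>j\<close>, \<open>l\<close>. The collision \<open>n = l\<close> is a paw outright;
  \<open>m = l\<close> leaves triangles weighted by \<open>k i - 2\<close>, again paws by
  \<open>M15_sum\<close>. Together they give the 4.\<close>

lemma M77_dsum:
  "2 * count_sub M77 G = dsum2 V (\<lambda>i j. a i j * ((k i - 1) * (k i - 2) * (k j - 1))) - 4 * count_sub M15 G"
proof -
  have P: "dsum5 V (\<lambda>i j l m n. a i j * a j l * a i m * a i n) = 2 * count_sub M77 G"
    by (rule dsum5_countI[of M77 "[5, 3, 4, 1, 2]" "[(0, 1), (1, 2), (0, 3), (0, 4)]" 2]) (code_simp, simp_all)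
  have Q: "dsum4 V (\<lambda>i j l m. a i j * a j l * a i m * a i l) = 2 * count_sub M15 G"
    by (rule dsum4_countI[of M15 "[4, 2, 3, 1]" "[(0, 1), (1, 2), (0, 3), (0, 2)]" 2]) (code_simp, simp_all)
  have E1: "dsum5 V (\<lambda>i j l m n. a i j * a j l * a i m * a i n) = dsum4 V (\<lambda>i j l m. a i j * a j l * a i m * (k i - 2)) - dsum4 V (\<lambda>i j l m. a i j * a j l * a i m * a i l)"
    by (unfold dsum4_diff[symmetric], rule dsum5_reduce, unfold sum_out, elim disjE; simp add: algebra_simps)
  have E2: "dsum4 V (\<lambda>i j l m. a i j * a j l * a i m * (k i - 2)) = dsum3 V (\<lambda>i j l. a i j * a j l * ((k i - 1) * (k i - 2))) - dsum3 V (\<lambda>i j l. a i j * (a i l * a l j) * (k i - 2))"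
    by (unfold dsum3_diff[symmetric], rule dsum4_reduce, unfold sum_out, elim disjE; simp add: algebra_simps)
  have E3: "dsum3 V (\<lambda>i j l. a i j * a j l * ((k i - 1) * (k i - 2))) = dsum2 V (\<lambda>i j. a i j * ((k i - 1) * (k i - 2) * (k j - 1)))"
    by (rule dsum3_reduce) (unfold sum_out, elim disjE; simp add: algebra_simps)
  show ?thesis using P Q E1 E2 E3 triangle_sum[of "\<lambda>i. k i - 2"] M15_sum by simp
qed

lemma M79_sum:
  "4 * count_sub M79 G = (\<Sum>i\<in>V. g3 i i * ((k i - 2) * (k i - 3)))"
proof -
  have P: "dsum5 V (\<lambda>i j r m n. a i j * (a i r * a r j) * a i m * a i n) = 4 * count_sub M79 G"
    by (rule dsum5_countI[of M79 "[5, 3, 4, 1, 2]" "[(0, 1), (0, 2), (2, 1), (0, 3), (0, 4)]" 4]) (code_simp, simp_all)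
  have E1: "dsum5 V (\<lambda>i j r m n. a i j * (a i r * a r j) * a i m * a i n) = dsum4 V (\<lambda>i j r m. a i j * (a i r * a r j) * a i m * (k i - 3))"
    by (rule dsum5_reduce) (unfold sum_out, elim disjE; simp add: algebra_simps)
  have E2: "dsum4 V (\<lambda>i j r m. a i j * (a i r * a r j) * a i m * (k i - 3)) = dsum3 V (\<lambda>i j r. a i j * (a i r * a r j) * ((k i - 2) * (k i - 3)))"
    by (rule dsum4_reduce) (unfold sum_out, elim disjE; simp add: algebra_simps)
  show ?thesis using P E1 E2 triangle_sum[of "\<lambda>i. (k i - 2) * (k i - 3)"] by simp
qed

text \<open>The path is i-u-v-w-j. Its middle \<open>v\<close> comes before \<open>u\<close> and
  \<open>w\<close>, so that removing these leaves \<open>g2 i v * g2 v j\<close>, which sums to the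
  fourth power. The cases \<open>v = i\<close> and \<open>v = j\<close> leave a degree by
  \<open>g2_self\<close>, and that degree is evaluated through \<open>M13\<close>.\<close>

lemma M86_dsum:
  "2 * count_sub M86 G = dsum2 V (adj_pow G 4) - 4 * count_sub M3 G - 18 * count_sub M7 G - 6 * count_sub M11 G - 4 * count_sub M13 G - 4 * count_sub M15 G"
proof -
  have P: "dsum5 V (\<lambda>i j v u w. a i u * a u v * (a v w * a w j)) = 2 * count_sub M86 G"
    by (rule dsum5_countI[of M86 "[1, 2, 3, 5, 4]" "[(0, 3), (3, 2), (2, 4), (4, 1)]" 2]) (code_simp, simp_all)
  have Q1: "dsum4 V (\<lambda>i j v u. a i u * a u v * a v i * a i j) = 2 * count_sub M15 G"
    by (rule dsum4_countI[of M15 "[4, 1, 2, 3]" "[(0, 3), (3, 2), (2, 0), (0, 1)]" 2]) (code_simp, simp_all)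
  have Q2: "dsum4 V (\<lambda>i j v u. a i u * a u v * a u j) = 6 * count_sub M11 G"
    by (rule dsum4_countI[of M11 "[1, 2, 3, 4]" "[(0, 3), (3, 2), (3, 1)]" 6]) (code_simp, simp_all)
  have Q3: "dsum4 V (\<lambda>i j v m. a i j * a j v * (a v m * a m j)) = 2 * count_sub M15 G"
    by (rule dsum4_countI[of M15 "[1, 4, 2, 3]" "[(0, 1), (1, 2), (2, 3), (3, 1)]" 2]) (code_simp, simp_all)
  have Q4: "dsum4 V (\<lambda>i j u m. a i u * a u j * a i m) = 2 * count_sub M13 G"
    by (rule dsum4_countI[of M13 "[3, 1, 4, 2]" "[(0, 2), (2, 1), (0, 3)]" 2]) (code_simp, simp_all)
  \<comment> \<open>The vertex \<open>w\<close> may collide with \<open>i\<close>, giving a paw, or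
    with \<open>u\<close>, giving a claw.\<close>
  have E1: "dsum5 V (\<lambda>i j v u w. a i u * a u v * (a v w * a w j)) = dsum4 V (\<lambda>i j v u. a i u * a u v * g2 v j) - dsum4 V (\<lambda>i j v u. a i u * a u v * a v i * a i j) - dsum4 V (\<lambda>i j v u. a i u * a u v * a u j)"
    by (unfold dsum4_diff[symmetric], rule dsum5_reduce, unfold sum_out, elim disjE; simp add: algebra_simps)
  have E2: "dsum4 V (\<lambda>i j v u. a i u * a u v * g2 v j) = dsum3 V (\<lambda>i j v. g2 i v * g2 v j) - dsum3 V (\<lambda>i j v. a i j * a j v * g2 v j)"
    by (unfold dsum3_diff[symmetric], rule dsum4_reduce, unfold sum_out, elim disjE; simp add: algebra_simps)
  have E3: "dsum4 V (\<lambda>i j v m. a i j * a j v * (a v m * a m j)) = dsum3 V (\<lambda>i j v. a i j * a j v * g2 v j) - dsum3 V (\<lambda>i j v. a i j * (a i v * a v j))"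
    by (unfold dsum3_diff[symmetric], rule dsum4_reduce, unfold sum_out, elim disjE; simp add: algebra_simps)
  have E4: "dsum3 V (\<lambda>i j v. g2 i v * g2 v j) = dsum2 V (adj_pow G 4) - dsum2 V (\<lambda>i j. g2 i j * k i) - dsum2 V (\<lambda>i j. g2 i j * k j)"
    by (unfold dsum2_diff[symmetric], rule dsum3_reduce, unfold sum_out, simp add: g2_self)
  have E5: "dsum4 V (\<lambda>i j u m. a i u * a u j * a i m) = dsum3 V (\<lambda>i j u. a i u * a u j * k i) - dsum3 V (\<lambda>i j u. a i u * a u j) - dsum3 V (\<lambda>i j u. a i j * (a i u * a u j))"
    by (unfold dsum3_diff[symmetric], rule dsum4_reduce, unfold sum_out, elim disjE; simp add: algebra_simps)
  have E6: "dsum3 V (\<lambda>i j u. a i u * a u j * k i) = dsum2 V (\<lambda>i j. g2 i j * k i)"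
    by (rule dsum3_reduce) (unfold sum_out, elim disjE; simp add: algebra_simps)
  have E7: "dsum2 V (\<lambda>i j. g2 i j * k j) = dsum2 V (\<lambda>i j. g2 i j * k i)"
    by (subst dsum2_swap) (simp_all add: g2_commute)
  have E8: "dsum3 V (\<lambda>i j u. a i u * a u j) = dsum2 V g2"
    by (rule dsum3_reduce) (unfold sum_out, elim disjE; simp add: algebra_simps)
  show ?thesis using P Q1 Q2 Q3 Q4 E1 E2 E3 E4 E5 E6 E7 E8 triangle_count M3_dsum by simp
qed

text \<open>When the pendants at \<open>i\<close> and \<open>j\<close> coincide, the graph becomes a
  diamond.\<close>

lemma M87_dsum:
  "2 * count_sub M87 G = dsum2 V (\<lambda>i j. a i j * (g2 i j * (k i - 2) * (k j - 2))) - 4 * count_sub M31 G"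
proof -
  have P: "dsum5 V (\<lambda>i j r m n. a i j * (a i r * a r j) * a i m * a j n) = 2 * count_sub M87 G"
    by (rule dsum5_countI[of M87 "[4, 5, 3, 2, 1]" "[(0, 1), (0, 2), (2, 1), (0, 3), (1, 4)]" 2]) (code_simp, simp_all)
  have Q: "dsum4 V (\<lambda>i j r m. a i j * (a i r * a r j) * a i m * a j m) = 4 * count_sub M31 G"
    by (rule dsum4_countI[of M31 "[3, 4, 1, 2]" "[(0, 1), (0, 2), (2, 1), (0, 3), (1, 3)]" 4]) (code_simp, simp_all)
  have E1: "dsum5 V (\<lambda>i j r m n. a i j * (a i r * a r j) * a i m * a j n) = dsum4 V (\<lambda>i j r m. a i j * (a i r * a r j) * a i m * (k j - 2)) - dsum4 V (\<lambda>i j r m. a i j * (a i r * a r j) * a i m * a j m)"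
    by (unfold dsum4_diff[symmetric], rule dsum5_reduce, unfold sum_out, elim disjE; simp add: algebra_simps)
  have E2: "dsum4 V (\<lambda>i j r m. a i j * (a i r * a r j) * a i m * (k j - 2)) = dsum3 V (\<lambda>i j r. a i j * (a i r * a r j) * ((k i - 2) * (k j - 2)))"
    by (rule dsum4_reduce) (unfold sum_out, elim disjE; simp add: algebra_simps)
  have E3: "dsum3 V (\<lambda>i j r. a i j * (a i r * a r j) * ((k i - 2) * (k j - 2))) = dsum2 V (\<lambda>i j. a i j * (g2 i j * (k i - 2) * (k j - 2)))"
    by (rule dsum3_reduce) (unfold sum_out, elim disjE; simp add: algebra_simps)
  show ?thesis using P Q E1 E2 E3 by simp
qed

text \<open>\<open>i\<close> and \<open>j\<close> are opposite on the 4-cycle. The pendant at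
  \<open>i\<close> may be \<open>j\<close>, and a 4-cycle with this chord is a diamond.\<close>

lemma M94_dsum:
  "2 * count_sub M94 G = dsum2 V (\<lambda>i j. g2 i j * (g2 i j - 1) * (k i - 2)) - 4 * count_sub M31 G"
proof -
  have P: "dsum5 V (\<lambda>i j u v m. (a i u * a u j) * (a i v * a v j) * a i m) = 2 * count_sub M94 G"
    by (rule dsum5_countI[of M94 "[5, 4, 2, 3, 1]" "[(0, 2), (2, 1), (0, 3), (3, 1), (0, 4)]" 2]) (code_simp, simp_all)
  have Q: "dsum4 V (\<lambda>i j u v. (a i u * a u j) * (a i v * a v j) * a i j) = 4 * count_sub M31 G"
    by (rule dsum4_countI[of M31 "[3, 4, 1, 2]" "[(0, 2), (2, 1), (0, 3), (3, 1), (0, 1)]" 4]) (code_simp, simp_all)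
  have E1: "dsum5 V (\<lambda>i j u v m. (a i u * a u j) * (a i v * a v j) * a i m) = dsum4 V (\<lambda>i j u v. (a i u * a u j) * (a i v * a v j) * (k i - 2)) - dsum4 V (\<lambda>i j u v. (a i u * a u j) * (a i v * a v j) * a i j)"
    by (unfold dsum4_diff[symmetric], rule dsum5_reduce, unfold sum_out, elim disjE; simp add: algebra_simps)
  have E2: "dsum4 V (\<lambda>i j u v. (a i u * a u j) * (a i v * a v j) * (k i - 2)) = dsum3 V (\<lambda>i j u. (a i u * a u j) * ((g2 i j - 1) * (k i - 2)))"
    by (rule dsum4_reduce) (unfold sum_out, elim disjE; simp add: algebra_simps)
  have E3: "dsum3 V (\<lambda>i j u. (a i u * a u j) * ((g2 i j - 1) * (k i - 2))) = dsum2 V (\<lambda>i j. g2 i j * (g2 i j - 1) * (k i - 2))"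
    by (rule dsum3_reduce) (unfold sum_out, elim disjE; simp add: algebra_simps)
  show ?thesis using P Q E1 E2 E3 by simp
qed

text \<open>There is no correction: \<open>i\<close> is adjacent to all three other vertices of the
  diamond, and these make up the \<open>- 3\<close>.\<close>

lemma M95_dsum:
  "2 * count_sub M95 G = dsum2 V (\<lambda>i j. a i j * (g2 i j * (g2 i j - 1) * (k i - 3)))"
proof -
  have P: "dsum5 V (\<lambda>i j u v m. a i j * (a i u * a u j) * (a i v * a v j) * a i m) = 2 * count_sub M95 G"
    by (rule dsum5_countI[of M95 "[5, 4, 2, 3, 1]" "[(0, 1), (0, 2), (2, 1), (0, 3), (3, 1), (0, 4)]" 2])
      (code_simp, simp_all)
  have E1: "dsum5 V (\<lambda>i j u v m. a i j * (a i u * a u j) * (a i v * a v j) * a i m) = dsum4 V (\<lambda>i j u v. a i j * (a i u * a u j) * (a i v * a v j) * (k i - 3))"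
    by (rule dsum5_reduce) (unfold sum_out, elim disjE; simp add: algebra_simps)
  have E2: "dsum4 V (\<lambda>i j u v. a i j * (a i u * a u j) * (a i v * a v j) * (k i - 3)) = dsum3 V (\<lambda>i j u. a i j * (a i u * a u j) * ((g2 i j - 1) * (k i - 3)))"
    by (rule dsum4_reduce) (unfold sum_out, elim disjE; simp add: algebra_simps)
  have E3: "dsum3 V (\<lambda>i j u. a i j * (a i u * a u j) * ((g2 i j - 1) * (k i - 3))) = dsum2 V (\<lambda>i j. a i j * (g2 i j * (g2 i j - 1) * (k i - 3)))"
    by (rule dsum3_reduce) (unfold sum_out, elim disjE; simp add: algebra_simps)
  show ?thesis using P E1 E2 E3 by simp
qed

text \<open>The triangle is i, y, z and the tail i, j, m. If \<open>m\<close> hits \<open>y\<close>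
  or \<open>z\<close>, diamonds arise. If \<open>j\<close> hits the triangle, \<open>z = j\<close>
  and \<open>y = j\<close> give the same sum, which E4 and E5 reduce to paws and triangles.\<close>

lemma M117_dsum:
  "2 * count_sub M117 G = dsum2 V (\<lambda>i j. a i j * (g3 i i * (k j - 1))) - 12 * count_sub M7 G - 4 * count_sub M15 G - 8 * count_sub M31 G"
proof -
  have P: "dsum5 V (\<lambda>i j y z m. a i j * a i y * (a i z * a z y) * a j m) = 2 * count_sub M117 G"
    by (rule dsum5_countI[of M117 "[4, 5, 2, 3, 1]" "[(0, 1), (0, 2), (0, 3), (3, 2), (1, 4)]" 2]) (code_simp, simp_all)
  have Q1: "dsum4 V (\<lambda>i j y z. a i j * a i y * (a i z * a z y) * a j y) = 4 * count_sub M31 G"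
    by (rule dsum4_countI[of M31 "[3, 1, 4, 2]" "[(0, 1), (0, 2), (0, 3), (3, 2), (1, 2)]" 4]) (code_simp, simp_all)
  have Q2: "dsum4 V (\<lambda>i j y z. a i j * a i y * (a i z * a z y) * a j z) = 4 * count_sub M31 G"
    by (rule dsum4_countI[of M31 "[3, 1, 2, 4]" "[(0, 1), (0, 2), (0, 3), (3, 2), (1, 3)]" 4]) (code_simp, simp_all)
  have E1: "dsum5 V (\<lambda>i j y z m. a i j * a i y * (a i z * a z y) * a j m) = dsum4 V (\<lambda>i j y z. a i j * a i y * (a i z * a z y) * (k j - 1)) - dsum4 V (\<lambda>i j y z. a i j * a i y * (a i z * a z y) * a j y) - dsum4 V (\<lambda>i j y z. a i j * a i y * (a i z * a z y) * a j z)"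
    by (unfold dsum4_diff[symmetric], rule dsum5_reduce, unfold sum_out, elim disjE; simp add: algebra_simps)
  have E2: "dsum4 V (\<lambda>i j y z. a i j * a i y * (a i z * a z y) * (k j - 1)) = dsum3 V (\<lambda>i j y. a i j * (a i y * g2 i y) * (k j - 1)) - dsum3 V (\<lambda>i j y. a i j * (a i y * a y j) * (k j - 1))"
    by (unfold dsum3_diff[symmetric], rule dsum4_reduce, unfold sum_out, elim disjE; simp add: algebra_simps)
  have E3: "dsum3 V (\<lambda>i j y. a i j * (a i y * g2 i y) * (k j - 1)) = dsum2 V (\<lambda>i j. a i j * (g3 i i * (k j - 1))) - dsum2 V (\<lambda>i j. a i j * g2 i j * (k j - 1))"
    by (unfold dsum2_diff[symmetric], rule dsum3_reduce, unfold sum_out, elim disjE; simp add: algebra_simps)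
  have E4: "dsum3 V (\<lambda>i j y. a i j * (a i y * a y j) * (k j - 1)) = dsum2 V (\<lambda>i j. a i j * g2 i j * (k j - 1))"
    by (rule dsum3_reduce) (unfold sum_out, elim disjE; simp add: algebra_simps)
  have E5: "dsum3 V (\<lambda>i j y. a i j * (a i y * a y j) * (k j - 1)) = dsum3 V (\<lambda>i j y. a i j * (a i y * a y j) * k j) - dsum3 V (\<lambda>i j y. a i j * (a i y * a y j))"
    by (simp add: dsum3_diff[symmetric] algebra_simps)
  show ?thesis using P Q1 Q2 E1 E2 E3 E4 E5 triangle_deg_snd triangle_count by simp
qed

text \<open>The factor \<open>k r - 2\<close> depends on the summed vertex \<open>r\<close>, so an
  inner sum remains instead of a matrix entry. When the pendant at \<open>r\<close> collides with
  the other rim vertex \<open>s\<close>, the graph becomes \<open>K4\<close>.\<close>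

lemma M119_dsum:
  "2 * count_sub M119 G = dsum2 V (\<lambda>i j. a i j * (g2 i j - 1) * (\<Sum>r\<in>V. a i r * a r j * (k r - 2))) - 24 * count_sub M63 G"
proof -
  have P: "dsum5 V (\<lambda>i j r s m. a i j * (a i r * a r j) * (a i s * a s j) * a r m) = 2 * count_sub M119 G"
    by (rule dsum5_countI[of M119 "[3, 4, 5, 2, 1]" "[(0, 1), (0, 2), (2, 1), (0, 3), (3, 1), (2, 4)]" 2])
      (code_simp, simp_all)
  have Q: "dsum4 V (\<lambda>i j r s. a i j * (a i r * a r j) * (a i s * a s j) * a r s) = 24 * count_sub M63 G"
    by (rule dsum4_countI[of M63 "[1, 2, 3, 4]" "[(0, 1), (0, 2), (2, 1), (0, 3), (3, 1), (2, 3)]" 24]) (code_simp, simp_all)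
  have E1: "dsum5 V (\<lambda>i j r s m. a i j * (a i r * a r j) * (a i s * a s j) * a r m) = dsum4 V (\<lambda>i j r s. a i j * (a i r * a r j) * (a i s * a s j) * (k r - 2)) - dsum4 V (\<lambda>i j r s. a i j * (a i r * a r j) * (a i s * a s j) * a r s)"
    by (unfold dsum4_diff[symmetric], rule dsum5_reduce, unfold sum_out, elim disjE; simp add: algebra_simps)
  have E2: "dsum4 V (\<lambda>i j r s. a i j * (a i r * a r j) * (a i s * a s j) * (k r - 2)) = dsum3 V (\<lambda>i j r. a i j * (g2 i j - 1) * (a i r * a r j * (k r - 2)))"
    by (rule dsum4_reduce) (unfold sum_out, elim disjE; simp add: algebra_simps)
  have E3: "dsum3 V (\<lambda>i j r. a i j * (g2 i j - 1) * (a i r * a r j * (k r - 2))) = dsum2 V (\<lambda>i j. a i j * (g2 i j - 1) * (\<Sum>r\<in>V. a i r * a r j * (k r - 2)))"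
    by (rule dsum3_reduce) (simp add: sum_distrib_left)
  show ?thesis using P Q E1 E2 E3 by simp
qed

lemma M127_dsum:
  "6 * count_sub M127 G = dsum4 V (\<lambda>i x y z. (a i x * a i y * a i z) * (a x y * (a x z * a z y)) * (k i - 3))"
proof -
  have P: "dsum5 V (\<lambda>i x y z m. (a i x * a i y * a i z) * (a x y * (a x z * a z y)) * a i m) = 6 * count_sub M127 G"
    by (rule dsum5_countI[of M127 "[5, 2, 3, 4, 1]" "[(0, 1), (0, 2), (0, 3), (1, 2), (1, 3), (3, 2), (0, 4)]" 6])
      (code_simp, simp_all)
  have E1: "dsum5 V (\<lambda>i x y z m. (a i x * a i y * a i z) * (a x y * (a x z * a z y)) * a i m) = dsum4 V (\<lambda>i x y z. (a i x * a i y * a i z) * (a x y * (a x z * a z y)) * (k i - 3))"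
    by (rule dsum5_reduce) (unfold sum_out, elim disjE; simp add: algebra_simps)
  show ?thesis using P E1 by simp
qed

lemma M222_dsum:
  "12 * count_sub M222 G = dsum2 V (\<lambda>i j. (g2 i j * (g2 i j - 1) * (g2 i j - 2)))"
proof -
  have P: "dsum5 V (\<lambda>i j u v w. (a i u * a u j) * (a i v * a v j) * (a i w * a w j)) = 12 * count_sub M222 G"
    by (rule dsum5_countI[of M222 "[4, 5, 1, 2, 3]" "[(0, 2), (2, 1), (0, 3), (3, 1), (0, 4), (4, 1)]" 12])
      (code_simp, simp_all)
  have E1: "dsum5 V (\<lambda>i j u v w. (a i u * a u j) * (a i v * a v j) * (a i w * a w j)) = dsum4 V (\<lambda>i j u v. (a i u * a u j) * (a i v * a v j) * (g2 i j - 2))"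
    by (rule dsum5_reduce) (unfold sum_out, elim disjE; simp add: algebra_simps)
  have E2: "dsum4 V (\<lambda>i j u v. (a i u * a u j) * (a i v * a v j) * (g2 i j - 2)) = dsum3 V (\<lambda>i j u. (a i u * a u j) * ((g2 i j - 1) * (g2 i j - 2)))"
    by (rule dsum4_reduce) (unfold sum_out, elim disjE; simp add: algebra_simps)
  have E3: "dsum3 V (\<lambda>i j u. (a i u * a u j) * ((g2 i j - 1) * (g2 i j - 2))) = dsum2 V (\<lambda>i j. (g2 i j * (g2 i j - 1) * (g2 i j - 2)))"
    by (rule dsum3_reduce) (unfold sum_out, elim disjE; simp add: algebra_simps)
  show ?thesis using P E1 E2 E3 by simp
qed

lemma M223_dsum:
  "12 * count_sub M223 G = dsum2 V (\<lambda>i j. a i j * (g2 i j * (g2 i j - 1) * (g2 i j - 2)))"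
proof -
  have P: "dsum5 V (\<lambda>i j u v w. a i j * (a i u * a u j) * (a i v * a v j) * (a i w * a w j)) = 12 * count_sub M223 G"
    by (rule dsum5_countI[of M223 "[4, 5, 1, 2, 3]" "[(0, 1), (0, 2), (2, 1), (0, 3), (3, 1), (0, 4), (4, 1)]" 12])
      (code_simp, simp_all)
  have E1: "dsum5 V (\<lambda>i j u v w. a i j * (a i u * a u j) * (a i v * a v j) * (a i w * a w j)) = dsum4 V (\<lambda>i j u v. a i j * (a i u * a u j) * (a i v * a v j) * (g2 i j - 2))"
    by (rule dsum5_reduce) (unfold sum_out, elim disjE; simp add: algebra_simps)
  have E2: "dsum4 V (\<lambda>i j u v. a i j * (a i u * a u j) * (a i v * a v j) * (g2 i j - 2)) = dsum3 V (\<lambda>i j u. a i j * (a i u * a u j) * ((g2 i j - 1) * (g2 i j - 2)))"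
    by (rule dsum4_reduce) (unfold sum_out, elim disjE; simp add: algebra_simps)
  have E3: "dsum3 V (\<lambda>i j u. a i j * (a i u * a u j) * ((g2 i j - 1) * (g2 i j - 2))) = dsum2 V (\<lambda>i j. a i j * (g2 i j * (g2 i j - 1) * (g2 i j - 2)))"
    by (rule dsum3_reduce) (unfold sum_out, elim disjE; simp add: algebra_simps)
  show ?thesis using P E1 E2 E3 by simp
qed

text \<open>Two triangles share \<open>i\<close>. A vertex of the second hitting one of the first
  produces diamonds; removing \<open>u\<close> leaves 12 copies of \<open>M7\<close> as well, and
  these are the \<open>- 2\<close> in \<open>g3 i i * (g3 i i - 2)\<close>.\<close>

lemma M235_sum:
  "8 * count_sub M235 G = (\<Sum>i\<in>V. g3 i i * (g3 i i - 2)) - 16 * count_sub M31 G"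
proof -
  have P: "dsum5 V (\<lambda>i j r u v. a i j * (a i r * a r j) * a i u * (a i v * a v u)) = 8 * count_sub M235 G"
    by (rule dsum5_countI[of M235 "[5, 1, 4, 2, 3]" "[(0, 1), (0, 2), (2, 1), (0, 3), (0, 4), (4, 3)]" 8])
      (code_simp, simp_all)
  have Q1: "dsum4 V (\<lambda>i j r u. a i j * (a i r * a r j) * a i u * a j u) = 4 * count_sub M31 G"
    by (rule dsum4_countI[of M31 "[3, 4, 1, 2]" "[(0, 1), (0, 2), (2, 1), (0, 3), (1, 3)]" 4]) (code_simp, simp_all)
  have Q2: "dsum4 V (\<lambda>i j r u. a i j * (a i r * a r j) * a i u * a r u) = 4 * count_sub M31 G"
    by (rule dsum4_countI[of M31 "[3, 1, 4, 2]" "[(0, 1), (0, 2), (2, 1), (0, 3), (2, 3)]" 4]) (code_simp, simp_all)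
  have E1: "dsum5 V (\<lambda>i j r u v. a i j * (a i r * a r j) * a i u * (a i v * a v u)) = dsum4 V (\<lambda>i j r u. a i j * (a i r * a r j) * (a i u * g2 i u)) - dsum4 V (\<lambda>i j r u. a i j * (a i r * a r j) * a i u * a j u) - dsum4 V (\<lambda>i j r u. a i j * (a i r * a r j) * a i u * a r u)"
    by (unfold dsum4_diff[symmetric], rule dsum5_reduce, unfold sum_out, elim disjE; simp add: algebra_simps)
  have E2: "dsum4 V (\<lambda>i j r u. a i j * (a i r * a r j) * (a i u * g2 i u)) = dsum3 V (\<lambda>i j r. a i j * (a i r * a r j) * g3 i i) - dsum3 V (\<lambda>i j r. a i j * (a i r * a r j) * g2 i j) - dsum3 V (\<lambda>i j r. a i j * (a i r * a r j) * g2 i r)"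
    by (unfold dsum3_diff[symmetric], rule dsum4_reduce, unfold sum_out, elim disjE; simp add: algebra_simps)
  have E3: "(\<Sum>i\<in>V. g3 i i * (g3 i i - 2)) = (\<Sum>i\<in>V. g3 i i * g3 i i) - 2 * (\<Sum>i\<in>V. g3 i i * 1)"
    by (simp add: sum_subtractf sum_distrib_left algebra_simps)
  show ?thesis using P Q1 Q2 E1 E2 E3 triangle_g2_fst_snd triangle_g2_fst_thd triangle_count triangle_sum[of "\<lambda>i. g3 i i"] triangle_sum[of "\<lambda>_. 1"] by simp
qed

text \<open>A closed 5-walk that is not a 5-cycle stays on a triangle or a paw. Removing w, v, u, j
  in this order from the cycle i-u-j-w-v splits these walks off; the last removal leaves the
  diagonal terms \<open>g3 i i * k i\<close>.\<close>

lemma M236_trace: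
  "10 * count_sub M236 G = adj_pow_trace G 5 - 30 * count_sub M7 G - 10 * count_sub M15 G"
proof -
  have P: "dsum5 V (\<lambda>i j u v w. a i u * a u j * a i v * (a v w * a w j)) = 10 * count_sub M236 G"
    by (rule dsum5_countI[of M236 "[1, 2, 5, 4, 3]" "[(0, 2), (2, 1), (0, 3), (3, 4), (4, 1)]" 10]) (code_simp, simp_all)
  have Q1: "dsum4 V (\<lambda>i j u v. a i u * a u j * a i v * a i j) = 2 * count_sub M15 G"
    by (rule dsum4_countI[of M15 "[4, 2, 3, 1]" "[(0, 2), (2, 1), (0, 3), (0, 1)]" 2]) (code_simp, simp_all)
  have Q2: "dsum4 V (\<lambda>i j u v. a i u * a u j * a i v * a v u) = 2 * count_sub M15 G"
    by (rule dsum4_countI[of M15 "[2, 1, 4, 3]" "[(0, 2), (2, 1), (0, 3), (3, 2)]" 2]) (code_simp, simp_all)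
  have Q3: "dsum4 V (\<lambda>i j u m. a i u * a u j * (a u m * a m j)) = 2 * count_sub M15 G"
    by (rule dsum4_countI[of M15 "[1, 2, 4, 3]" "[(0, 2), (2, 1), (2, 3), (3, 1)]" 2]) (code_simp, simp_all)
  have E1: "dsum5 V (\<lambda>i j u v w. a i u * a u j * a i v * (a v w * a w j)) = dsum4 V (\<lambda>i j u v. a i u * a u j * (a i v * g2 v j)) - dsum4 V (\<lambda>i j u v. a i u * a u j * a i v * a i j) - dsum4 V (\<lambda>i j u v. a i u * a u j * a i v * a v u)"
    by (unfold dsum4_diff[symmetric], rule dsum5_reduce, unfold sum_out, elim disjE; simp add: algebra_simps)
  have E2: "dsum4 V (\<lambda>i j u v. a i u * a u j * (a i v * g2 v j)) = dsum3 V (\<lambda>i j u. a i u * a u j * g3 i j) - dsum3 V (\<lambda>i j u. a i j * (a i u * a u j) * k j) - dsum3 V (\<lambda>i j u. a i u * a u j * g2 u j)"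
    by (unfold dsum3_diff[symmetric], rule dsum4_reduce, unfold sum_out, elim disjE; simp add: algebra_simps g2_self)
  have E3: "dsum4 V (\<lambda>i j u m. a i u * a u j * (a u m * a m j)) = dsum3 V (\<lambda>i j u. a i u * a u j * g2 u j) - dsum3 V (\<lambda>i j u. a i j * (a i u * a u j))"
    by (unfold dsum3_diff[symmetric], rule dsum4_reduce, unfold sum_out, elim disjE; simp add: algebra_simps)
  have E4: "dsum3 V (\<lambda>i j u. a i u * a u j * g3 i j) = dsum2 V (\<lambda>i j. g3 i j * g2 i j)"
    by (rule dsum3_reduce) (unfold sum_out, elim disjE; simp add: algebra_simps)
  have E5: "dsum2 V (\<lambda>i j. g3 i j * g2 i j) = (\<Sum>i\<in>V. adj_pow G 5 i i - g3 i i * k i)"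
    by (rule dsum2_reduce) (simp add: sum_g3g2[symmetric] g2_self g2_commute)
  have E6: "adj_pow_trace G 5 = dsum2 V (\<lambda>i j. g3 i j * g2 i j) + (\<Sum>i\<in>V. g3 i i * k i)"
    by (simp add: E5 sum_subtractf adj_pow_trace_def mat_trace_def)
  show ?thesis using P Q1 Q2 Q3 E1 E2 E3 E4 E6 triangle_deg_fst triangle_deg_snd triangle_count triangle_sum[of k] by simp
qed

text \<open>The triangle with apex \<open>u\<close> and the square i, v, w, j share the edge from
  \<open>i\<close> to \<open>j\<close>. The collision \<open>w = i\<close> leaves a paw,
  \<open>w = u\<close> a diamond.\<close>

lemma M237_dsum:
  "2 * count_sub M237 G = dsum2 V (\<lambda>i j. a i j * (g3 i j * g2 i j)) - 18 * count_sub M7 G - 4 * count_sub M15 G - 8 * count_sub M31 G"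
proof -
  have P: "dsum5 V (\<lambda>i j u v w. a i j * (a i u * a u j) * a i v * (a v w * a w j)) = 2 * count_sub M237 G"
    by (rule dsum5_countI[of M237 "[4, 5, 1, 3, 2]" "[(0, 1), (0, 2), (2, 1), (0, 3), (3, 4), (4, 1)]" 2])
      (code_simp, simp_all)
  have Q2: "dsum4 V (\<lambda>i j u v. a i j * (a i u * a u j) * a i v * a v u) = 4 * count_sub M31 G"
    by (rule dsum4_countI[of M31 "[3, 1, 4, 2]" "[(0, 1), (0, 2), (2, 1), (0, 3), (3, 2)]" 4]) (code_simp, simp_all)
  have E1: "dsum5 V (\<lambda>i j u v w. a i j * (a i u * a u j) * a i v * (a v w * a w j)) = dsum4 V (\<lambda>i j u v. a i j * (a i u * a u j) * (a i v * g2 v j)) - dsum4 V (\<lambda>i j u v. a i j * (a i u * a u j) * a i v) - dsum4 V (\<lambda>i j u v. a i j * (a i u * a u j) * a i v * a v u)"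
    by (unfold dsum4_diff[symmetric], rule dsum5_reduce, unfold sum_out, elim disjE; simp add: algebra_simps)
  have E2: "dsum4 V (\<lambda>i j u v. a i j * (a i u * a u j) * (a i v * g2 v j)) = dsum3 V (\<lambda>i j u. a i j * (a i u * a u j) * g3 i j) - dsum3 V (\<lambda>i j u. a i j * (a i u * a u j) * k j) - dsum3 V (\<lambda>i j u. a i j * (a i u * a u j) * g2 u j)"
    by (unfold dsum3_diff[symmetric], rule dsum4_reduce, unfold sum_out, elim disjE; simp add: algebra_simps g2_self)
  have E3: "dsum3 V (\<lambda>i j u. a i j * (a i u * a u j) * g3 i j) = dsum2 V (\<lambda>i j. a i j * (g3 i j * g2 i j))"
    by (rule dsum3_reduce) (unfold sum_out, elim disjE; simp add: algebra_simps)
  show ?thesis using P M15_count Q2 E1 E2 E3 triangle_deg_snd triangle_g2_thd_snd by simp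
qed

text \<open>Here and in the next four lemmas \<open>i\<close> is adjacent to all other vertices, and
  the last factor is the summand of a four-vertex graphlet. The ratio of the two automorphism
  numbers is the number of such dominating vertices: 1, 2, 1, 3, 5.\<close>

lemma M239_dsum:
  "dsum5 V (\<lambda>i x y z w. (a i x * a i y * a i z * a i w) * (a x y * a x z * a y w)) = 2 * count_sub M239 G"
    by (rule dsum5_countI[of M239 "[5, 3, 4, 2, 1]" "[(0, 1), (0, 2), (0, 3), (0, 4), (1, 2), (1, 3), (2, 4)]" 2])
      (code_simp, simp_all)

lemma M255_dsum:
  "dsum5 V (\<lambda>i x y z w. (a i x * a i y * a i z * a i w) * (a x y * (a x z * a z y) * a x w)) = 4 * count_sub M255 G"
    by (rule dsum5_countI[of M255 "[4, 5, 2, 3, 1]" "[(0, 1), (0, 2), (0, 3), (0, 4), (1, 2), (1, 3), (3, 2), (1, 4)]" 4])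
      (code_simp, simp_all)

lemma M507_dsum:
  "dsum5 V (\<lambda>i x y z w. (a i x * a i y * a i z * a i w) * ((a x z * a z y) * (a x w * a w y))) = 8 * count_sub M507 G"
    by (rule dsum5_countI[of M507 "[5, 1, 2, 3, 4]" "[(0, 1), (0, 2), (0, 3), (0, 4), (1, 3), (3, 2), (1, 4), (4, 2)]" 8])
      (code_simp, simp_all)

lemma M511_dsum:
  "dsum5 V (\<lambda>i x y z w. (a i x * a i y * a i z * a i w) * (a x y * (a x z * a z y) * (a x w * a w y))) = 12 * count_sub M511 G"
    by (rule dsum5_countI[of M511 "[3, 4, 5, 1, 2]" "[(0, 1), (0, 2), (0, 3), (0, 4), (1, 2), (1, 3), (3, 2), (1, 4), (4, 2)]" 12])
      (code_simp, simp_all)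

lemma M1023_dsum:
  "dsum5 V (\<lambda>i x y z w. (a i x * a i y * a i z * a i w) * ((a x y * a x z * a x w) * (a y z * (a y w * a w z)))) = 120 * count_sub M1023 G"
    by (rule dsum5_countI[of M1023 "[1, 2, 3, 4, 5]" "[(0, 1), (0, 2), (0, 3), (0, 4), (1, 2), (1, 3), (1, 4), (2, 3), (2, 4), (4, 3)]" 120])
      (code_simp, simp_all)

text \<open>The \<open>- 2\<close> accounts for \<open>i\<close> and \<open>j\<close>, which are
  already common neighbours of \<open>r\<close> and \<open>q\<close>.\<close>

lemma M254_dsum:
  "4 * count_sub M254 G = dsum4 V (\<lambda>i j r q. a i j * (a i r * a r j) * (a i q * a q j) * (g2 r q - 2))"
proof -
  have P: "dsum5 V (\<lambda>i j r q m. a i j * (a i r * a r j) * (a i q * a q j) * (a r m * a m q)) = 4 * count_sub M254 G"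
    by (rule dsum5_countI[of M254 "[2, 3, 4, 5, 1]" "[(0, 1), (0, 2), (2, 1), (0, 3), (3, 1), (2, 4), (4, 3)]" 4])
      (code_simp, simp_all)
  have E1: "dsum5 V (\<lambda>i j r q m. a i j * (a i r * a r j) * (a i q * a q j) * (a r m * a m q)) = dsum4 V (\<lambda>i j r q. a i j * (a i r * a r j) * (a i q * a q j) * (g2 r q - 2))"
    by (rule dsum5_reduce) (unfold sum_out, elim disjE; simp add: algebra_simps)
  show ?thesis using P E1 by simp
qed

end

section \<open>Sums over arcs, edges and neighbourhoods\<close>

lemma gchoose_expand:
  fixes x :: real
  shows "x gchoose 2 = x * (x - 1) / 2"
    and "x gchoose 3 = x * (x - 1) * (x - 2) / 6"
    and "x gchoose 4 = x * (x - 1) * (x - 2) * (x - 3) / 24"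
  by (simp_all add: gbinomial_prod_rev numeral_eq_Suc)

section \<open>Sums over a subset as sums weighted by its indicator\<close>

lemma sum_restrict:
  assumes "finite V" "W \<subseteq> V" "\<And>x. x \<in> W \<Longrightarrow> c x = 1" "\<And>x. x \<in> V - W \<Longrightarrow> c x = 0"
  shows "sum h W = (\<Sum>x\<in>V. c x * h x :: real)"
proof -
  have "(\<Sum>x\<in>V. c x * h x) = (\<Sum>x\<in>W. c x * h x)"
    using assms by (intro sum.mono_neutral_right) auto
  also have "\<dots> = sum h W" using assms by (intro sum.cong) auto
  finally show ?thesis by simp
qed

lemma dsum2_restrict:
  assumes "finite V" "W \<subseteq> V" "\<And>x. x \<in> W \<Longrightarrow> c x = 1" "\<And>x. x \<in> V - W \<Longrightarrow> c x = 0"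
  shows "dsum2 W f = dsum2 V (\<lambda>x y. c x * c y * f x y)"
proof -
  have "dsum2 W f = (\<Sum>x\<in>W. \<Sum>y\<in>V - {x}. c y * f x y)"
    unfolding dsum2_def using assms by (intro sum.cong sum_restrict refl) auto
  also have "\<dots> = (\<Sum>x\<in>V. c x * (\<Sum>y\<in>V - {x}. c y * f x y))"
    using assms by (rule sum_restrict)
  finally show ?thesis by (simp add: dsum2_def sum_distrib_left mult.assoc)
qed

lemma dsum3_restrict:
  assumes "finite V" "W \<subseteq> V" "\<And>x. x \<in> W \<Longrightarrow> c x = 1" "\<And>x. x \<in> V - W \<Longrightarrow> c x = 0"
  shows "dsum3 W f = dsum3 V (\<lambda>x y z. c x * c y * c z * f x y z)"
proof -
  have "dsum3 W f = (\<Sum>x\<in>W. dsum2 (V - {x}) (\<lambda>y z. c y * c z * f x y z))"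
    unfolding dsum3_def using assms by (intro sum.cong dsum2_restrict refl) auto
  also have "\<dots> = (\<Sum>x\<in>V. c x * dsum2 (V - {x}) (\<lambda>y z. c y * c z * f x y z))"
    using assms by (rule sum_restrict)
  finally show ?thesis by (simp add: dsum3_def dsum2_scale[symmetric] mult.assoc)
qed

lemma dsum4_restrict:
  assumes "finite V" "W \<subseteq> V" "\<And>x. x \<in> W \<Longrightarrow> c x = 1" "\<And>x. x \<in> V - W \<Longrightarrow> c x = 0"
  shows "dsum4 W f = dsum4 V (\<lambda>x y z w. c x * c y * c z * c w * f x y z w)"
proof -
  have "dsum4 W f = (\<Sum>x\<in>W. dsum3 (V - {x}) (\<lambda>y z w. c y * c z * c w * f x y z w))"
    unfolding dsum4_def using assms by (intro sum.cong dsum3_restrict refl) auto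
  also have "\<dots> = (\<Sum>x\<in>V. c x * dsum3 (V - {x}) (\<lambda>y z w. c y * c z * c w * f x y z w))"
    using assms by (rule sum_restrict)
  finally show ?thesis by (simp add: dsum4_def dsum3_scale[symmetric] mult.assoc)
qed

lemma sum_pairs:
  assumes "finite V" "S \<subseteq> distinct_pairs V"
  shows "(\<Sum>(i, j)\<in>S. f i j) = dsum2 V (\<lambda>i j. if (i, j) \<in> S then f i j else 0)"
proof -
  have "distinct_pairs V = (SIGMA i:V. V - {i})" by (auto simp: distinct_pairs_def)
  then have "dsum2 V (\<lambda>i j. if (i, j) \<in> S then f i j else 0) =
      (\<Sum>(i, j)\<in>distinct_pairs V. if (i, j) \<in> S then f i j else 0)"
    using assms(1) by (simp add: dsum2_def sum.Sigma)
  also have "\<dots> = (\<Sum>p\<in>distinct_pairs V. if p \<in> S then case_prod f p else 0)"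
    by (intro sum.cong) auto
  also have "\<dots> = sum (case_prod f) (distinct_pairs V \<inter> S)"
    using assms(1) \<open>distinct_pairs V = _\<close> by (subst sum.inter_restrict) auto
  also have "distinct_pairs V \<inter> S = S" using assms(2) by blast
  finally show ?thesis by simp
qed

section \<open>Sums over unordered pairs\<close>

lemma orient_choice:
  assumes "\<And>e. e \<in> P \<Longrightarrow> card e = 2"
  obtains s where "orient P = s ` P" "\<And>e. e \<in> P \<Longrightarrow> {fst (s e), snd (s e)} = e"
proof
  let ?s = "\<lambda>e :: 'a set. SOME p. e = {fst p, snd p}"
  show "orient P = ?s ` P" by (simp add: orient_def)
  fix e assume e: "e \<in> P"
  obtain u v where "e = {u, v}" using assms[OF e] by (auto simp: card_2_iff)
  then have "e = {fst (u, v), snd (u, v)}" by simp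
  then show "{fst (?s e), snd (?s e)} = e" by (rule someI[THEN sym])
qed

lemma orient_pair:
  assumes "\<And>e. e \<in> P \<Longrightarrow> card e = 2"
  shows "(i, j) \<in> orient P \<Longrightarrow> {i, j} \<in> P"
    and "{i, j} \<in> P \<Longrightarrow> (i, j) \<in> orient P \<longleftrightarrow> (j, i) \<notin> orient P"
proof -
  obtain s where s: "orient P = s ` P" "\<And>e. e \<in> P \<Longrightarrow> {fst (s e), snd (s e)} = e"
    using orient_choice[OF assms] by blast
  have mem: "(u, v) \<in> orient P \<longleftrightarrow> {u, v} \<in> P \<and> s {u, v} = (u, v)" for u v
  proof
    assume "(u, v) \<in> orient P"
    then obtain e where e: "e \<in> P" "s e = (u, v)" using s(1) by auto
    then have "e = {u, v}" using s(2)[of e] by simp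
    with e show "{u, v} \<in> P \<and> s {u, v} = (u, v)" by simp
  next
    assume "{u, v} \<in> P \<and> s {u, v} = (u, v)"
    then show "(u, v) \<in> orient P" using s(1) by (metis imageI)
  qed
  show "{i, j} \<in> P" if "(i, j) \<in> orient P"
    using that mem by blast
  show "(i, j) \<in> orient P \<longleftrightarrow> (j, i) \<notin> orient P" if ij: "{i, j} \<in> P"
  proof -
    have "i \<noteq> j" using assms[OF ij] by auto
    moreover have "s {i, j} = (i, j) \<or> s {i, j} = (j, i)"
      using s(2)[OF ij] by (cases "s {i, j}") (auto simp: doubleton_eq_iff)
    ultimately show ?thesis using ij mem[of i j] mem[of j i] by (auto simp: insert_commute)
  qed
qed

text \<open>The chosen orientations and their converses partition the ordered pairs in question, and
  symmetry makes both halves equal. This trades the arbitrary choice in \<open>orient\<close> for an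
  ordered sum.\<close>

lemma sum_orient:
  assumes V: "finite V" and P: "P \<subseteq> unordered_pairs V"
    and sym: "\<And>i j. f i j = f j i" "\<And>i j. Q i j = Q j i"
  shows "2 * (\<Sum>(i, j)\<in>{(i, j) \<in> orient P. Q i j}. f i j) =
    dsum2 V (\<lambda>i j. if {i, j} \<in> P \<and> Q i j then f i j else 0)"
proof -
  have card2: "card e = 2" if "e \<in> P" for e using P that by (auto simp: unordered_pairs_def)
  note o = orient_pair[of P, OF card2]
  define S where "S = {(i, j) \<in> orient P. Q i j}"
  define S' where "S' = {(j, i) \<in> orient P. Q j i}\<inverse>"
  have pairs: "S \<union> S' \<subseteq> distinct_pairs V"
  proof -
    have "{(i, j). {i, j} \<in> P} \<subseteq> distinct_pairs V"
      using P card2 by (fastforce simp: unordered_pairs_def distinct_pairs_def)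
    moreover have "S \<union> S' \<subseteq> {(i, j). {i, j} \<in> P}"
    proof (rule subrelI)
      fix i j assume "(i, j) \<in> S \<union> S'"
      then show "(i, j) \<in> {(i, j). {i, j} \<in> P}"
        using o(1)[of i j] o(1)[of j i] unfolding S_def S'_def by (auto simp: insert_commute)
    qed
    ultimately show ?thesis by blast
  qed
  have fin: "finite S" "finite S'"
    by (rule finite_subset[of _ "V \<times> V"]; use pairs V in \<open>auto simp: distinct_pairs_def\<close>)+
  have disj: "S \<inter> S' = {}"
    using o unfolding S_def S'_def by blast
  have mem: "(i, j) \<in> S \<union> S' \<longleftrightarrow> {i, j} \<in> P \<and> Q i j" for i j
    using o[of i j] o[of j i] sym(2)[of i j] unfolding S_def S'_def by (auto simp: insert_commute)
  have "(\<Sum>(i, j)\<in>S'. f i j) = (\<Sum>(i, j)\<in>S. f i j)"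
    by (rule sum.reindex_bij_witness[of _ "\<lambda>(i, j). (j, i)" "\<lambda>(i, j). (j, i)"])
      (auto simp: S_def S'_def sym)
  then have "2 * (\<Sum>(i, j)\<in>S. f i j) = (\<Sum>(i, j)\<in>S \<union> S'. f i j)"
    by (simp add: sum.union_disjoint[OF fin disj])
  also have "\<dots> = dsum2 V (\<lambda>i j. if {i, j} \<in> P \<and> Q i j then f i j else 0)"
    unfolding sum_pairs[OF V pairs] mem ..
  finally show ?thesis unfolding S_def .
qed

lemma card_orient:
  assumes "\<And>e. e \<in> P \<Longrightarrow> card e = 2"
  shows "card (orient P) = card P"
proof -
  obtain s where s: "orient P = s ` P" "\<And>e. e \<in> P \<Longrightarrow> {fst (s e), snd (s e)} = e"
    using orient_choice[OF assms] by blast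
  have "inj_on s P"
    by (rule inj_on_inverseI[where g = "\<lambda>p. {fst p, snd p}"]) (rule s(2))
  then show ?thesis unfolding s(1) by (rule card_image)
qed

text \<open>Puts integrality back into real-valued degrees and codegrees, so that the values
  excluded by a side condition can be checked one by one.\<close>

lemma real_le_3_cases: "real n = 0 \<or> real n = 1 \<or> real n = 2 \<or> real n = 3 \<or> 3 < real n"
proof -
  have "n = 0 \<or> n = 1 \<or> n = 2 \<or> n = 3 \<or> 3 < n" by linarith
  then show ?thesis by auto
qed

context simple_graph
begin

lemma a_one_verts: "a x y = 1 \<Longrightarrow> x \<in> V \<and> y \<in> V"
  using a_outside[of x y] by auto

lemma edges_unordered: "edges G \<subseteq> unordered_pairs V"
  using simple by (auto simp: finite_simple_graph_def unordered_pairs_def)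

lemma arcs_iff: "(i, j) \<in> arcs G \<longleftrightarrow> a i j = 1"
  by (simp add: arcs_def adj_def)

lemma edge_iff: "{i, j} \<in> edges G \<longleftrightarrow> a i j = 1"
  by (simp add: adj_def)

lemma sum_distinct_pairs_filter:
  assumes "\<And>i j. (if Q i j then f i j else 0) = g i j"
  shows "(\<Sum>(i, j)\<in>{(i, j) \<in> distinct_pairs V. Q i j}. f i j) = dsum2 V g"
proof -
  have "{(i, j) \<in> distinct_pairs V. Q i j} \<subseteq> distinct_pairs V" by auto
  from sum_pairs[OF finV this, of f] show ?thesis
    by (rule trans) (auto simp: distinct_pairs_def assms[symmetric] intro!: dsum2_cong)
qed

lemma sum_arcs_filter:
  assumes "\<And>i j. a i j = 1 \<Longrightarrow> (if Q i j then f i j else 0) = g i j"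
  shows "(\<Sum>(i, j)\<in>{(i, j) \<in> arcs G. Q i j}. f i j) = dsum2 V (\<lambda>i j. a i j * g i j)"
proof -
  have "{(i, j) \<in> arcs G. Q i j} \<subseteq> distinct_pairs V"
    using a_one_verts by (auto simp: arcs_iff distinct_pairs_def)
  from sum_pairs[OF finV this, of f] show ?thesis
  proof (rule trans, intro dsum2_cong)
    fix i j
    show "(if (i, j) \<in> {(i, j) \<in> arcs G. Q i j} then f i j else 0) = a i j * g i j"
      using assms[of i j] a_cases[of i j] by (auto simp: arcs_iff)
  qed
qed

lemma sum_distinct_pairs: "(\<Sum>(i, j)\<in>distinct_pairs V. f i j) = dsum2 V f"
  using sum_distinct_pairs_filter[of "\<lambda>_ _. True" f f] by simp

lemma sum_arcs: "(\<Sum>(i, j)\<in>arcs G. f i j) = dsum2 V (\<lambda>i j. a i j * f i j)"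
  using sum_arcs_filter[of "\<lambda>_ _. True" f f] by simp

lemma sum_edges_filter:
  assumes "\<And>i j. f i j = f j i" "\<And>i j. Q i j = Q j i"
    and "\<And>i j. a i j = 1 \<Longrightarrow> (if Q i j then f i j else 0) = g i j"
  shows "2 * (\<Sum>(i, j)\<in>{(i, j) \<in> orient (edges G). Q i j}. f i j) = dsum2 V (\<lambda>i j. a i j * g i j)"
  unfolding sum_orient[OF finV edges_unordered assms(1,2)] edge_iff
proof (rule dsum2_cong)
  fix i j
  show "(if a i j = 1 \<and> Q i j then f i j else 0) = a i j * g i j"
    using assms(3)[of i j] a_cases[of i j] by auto
qed

lemma sum_edges:
  assumes "\<And>i j. f i j = f j i"
  shows "2 * (\<Sum>(i, j)\<in>orient (edges G). f i j) = dsum2 V (\<lambda>i j. a i j * f i j)"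
  using sum_edges_filter[of f "\<lambda>_ _. True" f] assms by simp

text \<open>The handshake identity, from summing 1 over one orientation of each edge.\<close>

lemma sum_deg: "(\<Sum>i\<in>V. k i) = 2 * real (card (edges G))"
proof -
  have "2 * (\<Sum>(i, j)\<in>orient (edges G). 1) = dsum2 V (\<lambda>i j. a i j * 1)"
    by (rule sum_edges) simp
  also have "\<dots> = (\<Sum>i\<in>V. k i)"
    by (rule dsum2_reduce) (simp add: sum_a)
  finally show ?thesis
    using simple by (simp add: card_orient finite_simple_graph_def case_prod_beta)
qed

section \<open>Neighbourhoods and degree bounds\<close>

lemma nbrs_iff: "x \<in> nbrs G i \<longleftrightarrow> a i x = 1"
  using a_one_verts[of i x] by (auto simp: nbrs_def edge_iff)

lemma nbrs_subset: "nbrs G i \<subseteq> V - {i}"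
  using a_one_verts by (auto simp: nbrs_iff)

lemma common_nbrs_iff: "x \<in> common_nbrs G i j \<longleftrightarrow> a i x * a x j = 1"
  using a_cases[of i x] a_cases[of x j] by (auto simp: common_nbrs_def nbrs_iff a_commute[of j x])

lemma finite_nbrs [simp]: "finite (nbrs G i)"
  using nbrs_subset finV by (meson finite_Diff finite_subset)

lemma deg_card: "k i = real (card (nbrs G i))"
proof -
  have "(\<Sum>x\<in>nbrs G i. 1) = (\<Sum>x\<in>V. a i x * 1)"
    by (rule sum_restrict) (use nbrs_subset a_cases in \<open>auto simp: nbrs_iff\<close>)
  then show ?thesis by (simp add: sum_a)
qed

lemma finite_common_nbrs [simp]: "finite (common_nbrs G i j)"
  by (simp add: common_nbrs_def)

lemma sum_common_nbrs: "(\<Sum>r\<in>common_nbrs G i j. f r) = (\<Sum>r\<in>V. a i r * a r j * f r)"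
proof (rule sum_restrict)
  show "common_nbrs G i j \<subseteq> V" using nbrs_subset by (auto simp: common_nbrs_def)
  show "a i x * a x j = 0" if "x \<in> V - common_nbrs G i j" for x
    using that a_cases[of i x] a_cases[of x j] by (auto simp: common_nbrs_iff)
qed (auto simp: common_nbrs_iff)

lemma g2_card: "g2 i j = real (card (common_nbrs G i j))"
  using sum_common_nbrs[of "\<lambda>_. 1" i j] by (simp add: sum_aa)

text \<open>A common neighbour of \<open>i\<close> and \<open>j\<close> is a neighbour of
  \<open>i\<close> other than \<open>j\<close>; if \<open>i\<close> and \<open>j\<close> are
  adjacent, \<open>j\<close> is one more. This bound is what makes most terms of small degree
  vanish.\<close>

lemma g2_le_deg: "g2 i j + a i j \<le> k i"
proof -
  have sub: "common_nbrs G i j \<subseteq> nbrs G i - {j}"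
    by (auto simp: common_nbrs_def nbrs_iff)
  then have "card (common_nbrs G i j) \<le> card (nbrs G i - {j})" by (intro card_mono) auto
  also have "\<dots> + (if a i j = 1 then 1 else 0) = card (nbrs G i)"
    using card_Suc_Diff1[of "nbrs G i" j] by (auto simp: nbrs_iff)
  finally have "card (common_nbrs G i j) + (if a i j = 1 then 1 else 0) \<le> card (nbrs G i)" by simp
  then show ?thesis
    using a_cases[of i j] unfolding deg_card g2_card by (auto split: if_splits)
qed

lemma g2_le_deg': "g2 i j + a i j \<le> k j"
  using g2_le_deg[of j i] by (simp add: g2_commute a_commute)

lemma deg_le2: "\<not> 2 < k i \<Longrightarrow> k i = 0 \<or> k i = 1 \<or> k i = 2"
  using real_le_3_cases[of "card (nbrs G i)"] unfolding deg_card by linarith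

lemma deg_le3: "\<not> 3 < k i \<Longrightarrow> k i = 0 \<or> k i = 1 \<or> k i = 2 \<or> k i = 3"
  using real_le_3_cases[of "card (nbrs G i)"] unfolding deg_card by linarith

lemma g2_le1: "g2 i j \<le> 1 \<Longrightarrow> g2 i j = 0 \<or> g2 i j = 1"
  using real_le_3_cases[of "card (common_nbrs G i j)"] unfolding g2_card by linarith

lemma g2_le2: "g2 i j \<le> 2 \<Longrightarrow> g2 i j = 0 \<or> g2 i j = 1 \<or> g2 i j = 2"
  using real_le_3_cases[of "card (common_nbrs G i j)"] unfolding g2_card by linarith

text \<open>For a neighbour \<open>v\<close> of \<open>i\<close>, \<open>g2 i v\<close> is at most
  \<open>k i - 1\<close>, which is below 1.\<close>

lemma g3_self_eq_0:
  assumes "k i < 2"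
  shows "g3 i i = 0"
proof -
  have "a i v * g2 i v = 0" for v
    using a_cases[of i v] g2_le_deg[of i v] g2_le1[of i v] assms by auto
  then show ?thesis unfolding sum_ag2'[symmetric] by (intro sum.neutral) blast
qed

lemma sum_filter:
  assumes "\<And>i. \<not> Q i \<Longrightarrow> f i = (0::real)"
  shows "(\<Sum>i\<in>{i \<in> V. Q i}. f i) = (\<Sum>i\<in>V. f i)"
  by (rule sum.mono_neutral_left) (auto simp: assms)

section \<open>Induced subgraphs and neighbourhood graphs\<close>

lemma induced_simple: "W \<subseteq> V \<Longrightarrow> simple_graph (induced G W)"
  using simple by (auto simp: simple_graph_def finite_simple_graph_def induced_def intro: finite_subset)

lemma verts_induced: "verts (induced G W) = W"
  by (simp add: induced_def)

lemma adj_induced: "x \<in> W \<Longrightarrow> y \<in> W \<Longrightarrow> adj (induced G W) x y = a x y"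
  by (simp add: induced_def adj_def)

lemma nbhd_simple: "simple_graph (nbhd_graph G i)"
  unfolding nbhd_graph_def using nbrs_subset by (intro induced_simple) auto

lemma verts_nbhd: "verts (nbhd_graph G i) = nbrs G i"
  by (simp add: nbhd_graph_def verts_induced)

lemma adj_nbhd: "x \<in> nbrs G i \<Longrightarrow> y \<in> nbrs G i \<Longrightarrow> adj (nbhd_graph G i) x y = a x y"
  by (simp add: nbhd_graph_def adj_induced)

lemma dsum3_nbrs: "dsum3 (nbrs G i) f = dsum3 (V - {i}) (\<lambda>x y z. a i x * a i y * a i z * f x y z)"
  using nbrs_subset a_cases by (intro dsum3_restrict) (auto simp: nbrs_iff)

lemma dsum4_nbrs:
  "dsum4 (nbrs G i) f = dsum4 (V - {i}) (\<lambda>x y z w. a i x * a i y * a i z * a i w * f x y z w)"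
  using nbrs_subset a_cases by (intro dsum4_restrict) (auto simp: nbrs_iff)

lemma sum_dsum4_nbrs:
  "dsum5 V (\<lambda>i x y z w. a i x * a i y * a i z * a i w * f x y z w) = (\<Sum>i\<in>V. dsum4 (nbrs G i) f)"
  by (simp add: dsum5_def dsum4_nbrs)

lemma trace3: "adj_pow_trace G 3 = 6 * count_sub M7 G"
  using triangle_sum[of "\<lambda>_. 1"] triangle_count by (simp add: adj_pow_trace_def mat_trace_def)

end

text \<open>Disposes of neighbourhoods too small to hold a copy, and so of the degree conditions in
  the formulas built on induced subgraphs.\<close>

lemma count_sub_eq_0:
  assumes "finite (verts G)" "card (verts G) < card (verts F)"
  shows "count_sub F G = 0"
proof -
  have "\<not> graph_iso K F" if "K \<in> subgraphs G" for K
  proof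
    assume "graph_iso K F"
    then have "card (verts K) = card (verts F)"
      unfolding graph_iso_def by (auto intro: bij_betw_same_card)
    moreover have "card (verts K) \<le> card (verts G)"
      using that assms(1) by (intro card_mono) (auto simp: subgraphs_def)
    ultimately show False using assms(2) by simp
  qed
  then have "{K \<in> subgraphs G. graph_iso K F} = {}" by blast
  then show ?thesis unfolding count_sub_def by (metis card.empty of_nat_0)
qed

context simple_graph
begin

lemma deg_ge_1: "a i j = 1 \<Longrightarrow> 1 \<le> k i"
  using g2_le_deg[of i j] by (simp add: g2_card)

lemma g2_nonneg: "0 \<le> g2 i j"
  by (simp add: g2_card)

lemma g2_eq_0_imp: "g2 i j = 0 \<Longrightarrow> common_nbrs G i j = {}"
  by (simp add: g2_card common_nbrs_def)

lemma common_nbrs_commute: "common_nbrs G i j = common_nbrs G j i"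
  by (auto simp: common_nbrs_def)

lemma deg_ge_2:
  assumes "a r i = 1" "a r j = 1" "i \<noteq> j"
  shows "2 \<le> k r"
proof -
  have "card {i, j} \<le> card (nbrs G r)"
    using assms by (intro card_mono) (auto simp: nbrs_iff)
  then show ?thesis using assms(3) by (simp add: deg_card)
qed

text \<open>The only possible closed 3-walks at \<open>i\<close> go round i, u, v in the two
  directions. Both values are roots of \<open>x * (x - 2)\<close>, the factor in the formula for
  \<open>M235\<close>.\<close>

lemma g3_self_deg_2:
  assumes "k i = 2"
  shows "g3 i i = 0 \<or> g3 i i = 2"
proof -
  obtain u v where uv: "nbrs G i = {u, v}" "u \<noteq> v"
    using assms by (auto simp: deg_card card_2_iff)
  have *: "(\<Sum>x\<in>V. a i x * f x) = f u + f v" for f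
  proof -
    have "(\<Sum>x\<in>nbrs G i. f x) = (\<Sum>x\<in>V. a i x * f x)"
      by (rule sum_restrict) (use nbrs_subset a_cases in \<open>auto simp: nbrs_iff\<close>)
    then show ?thesis using uv by simp
  qed
  have "g3 i i = 2 * a u v"
    unfolding sum_ag2'[symmetric] * sum_aa[symmetric] by (simp add: a_commute[of v u])
  then show ?thesis using a_cases[of u v] by auto
qed

text \<open>Closed 4-walks are the 8 traversals of each 4-cycle, 2 for each edge walked to and fro,
  and 4 for each \<open>M3\<close>: two starting at its centre, two at its ends.\<close>

lemma M30_trace: "8 * count_sub M30 G = adj_pow_trace G 4 - 2 * real (card (edges G)) - 4 * count_sub M3 G"
proof -
  have "dsum2 V (\<lambda>i j. g2 i j * (g2 i j - 1)) = (\<Sum>i\<in>V. adj_pow G 4 i i - k i * k i) - dsum2 V g2"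
  proof -
    have "dsum2 V (\<lambda>i j. g2 i j * g2 i j) = (\<Sum>i\<in>V. adj_pow G 4 i i - k i * k i)"
      by (rule dsum2_reduce) (simp add: sum_g2g2[symmetric] g2_self g2_commute)
    then show ?thesis by (simp add: right_diff_distrib dsum2_diff)
  qed
  moreover have "(\<Sum>i\<in>V. k i * (k i - 1)) = (\<Sum>i\<in>V. k i * k i) - (\<Sum>i\<in>V. k i)"
    by (simp add: sum_subtractf[symmetric] algebra_simps)
  ultimately show ?thesis
    using M30_dsum M3_dsum M3_sum sum_deg by (simp add: sum_subtractf adj_pow_trace_def mat_trace_def)
qed

text \<open>A nonzero binomial needs \<open>r\<close> and \<open>s\<close> adjacent with two common
  neighbours, which forces both degrees above 2.\<close>

lemma M31_pairs:
  "(\<Sum>(r, s)\<in>{(r, s) \<in> distinct_pairs V. k r > 2 \<and> k s > 2}. (g2 r s * a r s) gchoose 2) = 2 * count_sub M31 G"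
proof -
  have "(\<Sum>(r, s)\<in>{(r, s) \<in> distinct_pairs V. k r > 2 \<and> k s > 2}. (g2 r s * a r s) gchoose 2) =
      dsum2 V (\<lambda>i j. 1 / 2 * (a i j * (g2 i j * (g2 i j - 1))))"
  proof (rule sum_distinct_pairs_filter)
    fix i j
    show "(if k i > 2 \<and> k j > 2 then (g2 i j * a i j) gchoose 2 else 0) =
        1 / 2 * (a i j * (g2 i j * (g2 i j - 1)))"
      using a_cases[of i j] g2_le_deg[of i j] g2_le_deg'[of i j] g2_le1[of i j]
      by (auto simp: gchoose_expand)
  qed
  then show ?thesis using M31_dsum by (simp only: dsum2_scale)
qed

lemma M15_filter: "(\<Sum>r\<in>{r \<in> V. k r > 2}. g3 r r * (k r - 2)) = 2 * count_sub M15 G"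
proof -
  have "(\<Sum>r\<in>{r \<in> V. k r > 2}. g3 r r * (k r - 2)) = (\<Sum>r\<in>V. g3 r r * (k r - 2))"
    by (rule sum_filter) (use deg_le2 g3_self_eq_0 in fastforce)
  then show ?thesis using M15_sum by simp
qed

lemma M13_edges:
  "count_sub M13 G = (\<Sum>(i, j)\<in>orient (edges G). (k i - 1) * (k j - 1)) - 3 * count_sub M7 G"
  using sum_edges[of "\<lambda>i j. (k i - 1) * (k j - 1)"] M13_dsum by (simp add: mult.commute)

lemma count_nbhd_eq_0: "\<not> 3 < k i \<Longrightarrow> card (verts F) = 4 \<Longrightarrow> count_sub F (nbhd_graph G i) = 0"
  by (rule count_sub_eq_0) (auto simp: verts_nbhd deg_card)

text \<open>The second assumption says that \<open>f\<close> reads its matrix argument only at the four given vertices, so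
  that it cannot distinguish the adjacency matrix of the neighbourhood from that of \<open>G\<close>.\<close>

lemma sum_count_nbhd:
  assumes "\<And>H :: 'a graph. simple_graph H \<Longrightarrow> dsum4 (verts H) (f (adj H)) = c * count_sub F H"
    and "\<And>a' x y z w. (\<forall>u\<in>{x, y, z, w}. \<forall>v\<in>{x, y, z, w}. a' u v = a u v) \<Longrightarrow> f a' x y z w = f a x y z w"
    and "card (verts F) = 4"
  shows "dsum5 V (\<lambda>i x y z w. a i x * a i y * a i z * a i w * f a x y z w) =
    c * (\<Sum>i\<in>{i \<in> V. k i > 3}. count_sub F (nbhd_graph G i))"
proof -
  have "dsum4 (nbrs G i) (f a) = c * count_sub F (nbhd_graph G i)" for i
  proof -
    have "dsum4 (nbrs G i) (f a) = dsum4 (nbrs G i) (f (adj (nbhd_graph G i)))"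
      by (intro dsum4_cong assms(2)[symmetric]) (auto simp: adj_nbhd)
    then show ?thesis using assms(1)[OF nbhd_simple, of i] by (simp add: verts_nbhd)
  qed
  then show ?thesis
    using sum_filter[of "\<lambda>i. k i > 3" "\<lambda>i. count_sub F (nbhd_graph G i)"] count_nbhd_eq_0[OF _ assms(3)]
    by (simp add: sum_dsum4_nbrs sum_distrib_left)
qed

section \<open>The formulas\<close>

lemma M75_formula:
  "count_sub M75 G =
        (\<Sum>i\<in>{i \<in> verts G. deg G i > 3}. deg G i gchoose 4) \<and>
      (\<Sum>i\<in>{i \<in> verts G. deg G i > 3}. deg G i gchoose 4) =
        1/24 * (\<Sum>i\<in>{i \<in> verts G. deg G i > 3}. deg G i * (deg G i - 1) * (deg G i - 2) * (deg G i - 3))"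
proof -
  have "24 * count_sub M75 G = (\<Sum>i\<in>{i \<in> V. k i > 3}. k i * (k i - 1) * (k i - 2) * (k i - 3))"
    unfolding M75_sum by (rule sum_filter[symmetric]) (use deg_le3 in fastforce)
  moreover have "(\<Sum>i\<in>{i \<in> V. k i > 3}. k i gchoose 4) =
      1/24 * (\<Sum>i\<in>{i \<in> V. k i > 3}. k i * (k i - 1) * (k i - 2) * (k i - 3))"
    by (simp add: gchoose_expand sum_divide_distrib)
  ultimately show ?thesis by simp
qed

lemma M77_formula:
  "count_sub M77 G =
        (\<Sum>(i, j)\<in>{(i, j) \<in> arcs G. deg G i > 2}. ((deg G i - 1) gchoose 2) * (deg G j - 1)) - 2 * count_sub M15 G \<and>
      (\<Sum>(i, j)\<in>{(i, j) \<in> arcs G. deg G i > 2}. ((deg G i - 1) gchoose 2) * (deg G j - 1)) - 2 * count_sub M15 G =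
        1/2 * (\<Sum>(i, j)\<in>{(i, j) \<in> arcs G. deg G i > 2}. (deg G i - 1) * (deg G i - 2) * (deg G j - 1)) - 2 * count_sub M15 G"
proof -
  let ?S = "{(i, j) \<in> arcs G. k i > 2}"
  have "(\<Sum>(i, j)\<in>?S. (k i - 1) * (k i - 2) * (k j - 1)) =
      dsum2 V (\<lambda>i j. a i j * ((k i - 1) * (k i - 2) * (k j - 1)))"
  proof (rule sum_arcs_filter)
    fix i j assume "a i j = 1"
    then show "(if k i > 2 then (k i - 1) * (k i - 2) * (k j - 1) else 0) = (k i - 1) * (k i - 2) * (k j - 1)"
      \<comment> \<open>On an arc the excluded degrees are 1 and 2, both roots of the
        summand.\<close>
      using deg_ge_1[of i j] deg_le2[of i] by auto
  qed
  moreover have "(\<Sum>(i, j)\<in>?S. ((k i - 1) gchoose 2) * (k j - 1)) =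
      1/2 * (\<Sum>(i, j)\<in>?S. (k i - 1) * (k i - 2) * (k j - 1))"
    unfolding sum_distrib_left by (intro sum.cong refl) (auto simp: gchoose_expand)
  ultimately show ?thesis using M77_dsum by simp
qed

lemma M79_formula:
  "count_sub M79 G =
        1/2 * (\<Sum>i\<in>{i \<in> verts G. deg G i > 3}. adj_pow G 3 i i * ((deg G i - 2) gchoose 2)) \<and>
      1/2 * (\<Sum>i\<in>{i \<in> verts G. deg G i > 3}. adj_pow G 3 i i * ((deg G i - 2) gchoose 2)) =
        1/4 * (\<Sum>i\<in>{i \<in> verts G. deg G i > 3}. adj_pow G 3 i i * (deg G i - 2) * (deg G i - 3))"
proof -
  have "(\<Sum>i\<in>{i \<in> V. k i > 3}. g3 i i * (k i - 2) * (k i - 3)) = 4 * count_sub M79 G"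
    unfolding M79_sum mult.assoc
    by (rule sum_filter) (use deg_le3 g3_self_eq_0 in fastforce)
  moreover have "(\<Sum>i\<in>{i \<in> V. k i > 3}. g3 i i * ((k i - 2) gchoose 2)) =
      1/2 * (\<Sum>i\<in>{i \<in> V. k i > 3}. g3 i i * (k i - 2) * (k i - 3))"
    unfolding sum_distrib_left by (intro sum.cong refl) (auto simp: gchoose_expand)
  ultimately show ?thesis by simp
qed

lemma M86_formula:
  "count_sub M86 G =
        1/2 * (\<Sum>(i, j)\<in>distinct_pairs (verts G). adj_pow G 4 i j) - 2 * count_sub M3 G - 9 * count_sub M7 G - 3 * count_sub M11 G - 2 * count_sub M13 G - 2 * count_sub M15 G"
using M86_dsum by (simp add: sum_distinct_pairs)

lemma M87_formula:
  "count_sub M87 G =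
        (\<Sum>(i, j)\<in>{(i, j) \<in> orient (edges G). deg G i > 2 \<and> deg G j > 2}. adj_pow G 2 i j * (deg G i - 2) * (deg G j - 2)) - 2 * count_sub M31 G"
proof -
  have "2 * (\<Sum>(i, j)\<in>{(i, j) \<in> orient (edges G). k i > 2 \<and> k j > 2}. g2 i j * (k i - 2) * (k j - 2)) =
      dsum2 V (\<lambda>i j. a i j * (g2 i j * (k i - 2) * (k j - 2)))"
  proof (rule sum_edges_filter)
    fix i j assume a: "a i j = 1"
    show "(if k i > 2 \<and> k j > 2 then g2 i j * (k i - 2) * (k j - 2) else 0) = g2 i j * (k i - 2) * (k j - 2)"
      \<comment> \<open>An endpoint of degree 2 is a root of its own factor; degree 1 forces
        \<open>g2 i j = 0\<close>.\<close>
      using a deg_le2[of i] deg_le2[of j] g2_le_deg[of i j] g2_le_deg'[of i j] g2_nonneg[of i j] by auto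
  qed (auto simp: g2_commute)
  then show ?thesis using M87_dsum by simp
qed

lemma M94_formula:
  "count_sub M94 G =
        (\<Sum>(i, j)\<in>{(i, j) \<in> distinct_pairs (verts G). deg G i > 2}. (adj_pow G 2 i j gchoose 2) * (deg G i - 2)) - 2 * count_sub M31 G \<and>
      (\<Sum>(i, j)\<in>{(i, j) \<in> distinct_pairs (verts G). deg G i > 2}. (adj_pow G 2 i j gchoose 2) * (deg G i - 2)) - 2 * count_sub M31 G =
        1/2 * (\<Sum>(i, j)\<in>{(i, j) \<in> distinct_pairs (verts G). deg G i > 2}. adj_pow G 2 i j * (adj_pow G 2 i j - 1) * (deg G i - 2)) - 2 * count_sub M31 G"
proof -
  let ?S = "{(i, j) \<in> distinct_pairs V. k i > 2}"
  have "(\<Sum>(i, j)\<in>?S. g2 i j * (g2 i j - 1) * (k i - 2)) = dsum2 V (\<lambda>i j. g2 i j * (g2 i j - 1) * (k i - 2))"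
  proof (rule sum_distinct_pairs_filter)
    fix i j
    show "(if k i > 2 then g2 i j * (g2 i j - 1) * (k i - 2) else 0) = g2 i j * (g2 i j - 1) * (k i - 2)"
      using deg_le2[of i] g2_le_deg[of i j] a_cases[of i j] g2_le1[of i j] by auto
  qed
  moreover have "(\<Sum>(i, j)\<in>?S. (g2 i j gchoose 2) * (k i - 2)) =
      1/2 * (\<Sum>(i, j)\<in>?S. g2 i j * (g2 i j - 1) * (k i - 2))"
    unfolding sum_distrib_left by (intro sum.cong refl) (auto simp: gchoose_expand)
  ultimately show ?thesis using M94_dsum by simp
qed

lemma M95_formula:
  "count_sub M95 G =
        (\<Sum>(i, j)\<in>{(i, j) \<in> distinct_pairs (verts G). deg G i > 3}. ((adj_pow G 2 i j * adj G i j) gchoose 2) * (deg G i - 3)) \<and>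
      (\<Sum>(i, j)\<in>{(i, j) \<in> distinct_pairs (verts G). deg G i > 3}. ((adj_pow G 2 i j * adj G i j) gchoose 2) * (deg G i - 3)) =
        1/2 * (\<Sum>(i, j)\<in>{(i, j) \<in> arcs G. deg G i > 3}. adj_pow G 2 i j * (adj_pow G 2 i j - 1) * (deg G i - 3))"
proof -
  have "(\<Sum>(i, j)\<in>{(i, j) \<in> distinct_pairs V. k i > 3}. ((g2 i j * a i j) gchoose 2) * (k i - 3)) =
      dsum2 V (\<lambda>i j. 1/2 * (a i j * (g2 i j * (g2 i j - 1) * (k i - 3))))"
  proof (rule sum_distinct_pairs_filter)
    fix i j
    show "(if k i > 3 then ((g2 i j * a i j) gchoose 2) * (k i - 3) else 0) =
        1/2 * (a i j * (g2 i j * (g2 i j - 1) * (k i - 3)))"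
      using deg_le3[of i] g2_le_deg[of i j] a_cases[of i j] g2_le1[of i j] by (auto simp: gchoose_expand)
  qed
  moreover have "(\<Sum>(i, j)\<in>{(i, j) \<in> arcs G. k i > 3}. g2 i j * (g2 i j - 1) * (k i - 3)) =
      dsum2 V (\<lambda>i j. a i j * (g2 i j * (g2 i j - 1) * (k i - 3)))"
  proof (rule sum_arcs_filter)
    fix i j assume "a i j = 1"
    then show "(if k i > 3 then g2 i j * (g2 i j - 1) * (k i - 3) else 0) = g2 i j * (g2 i j - 1) * (k i - 3)"
      using deg_le3[of i] g2_le_deg[of i j] g2_le1[of i j] by auto
  qed
  ultimately show ?thesis using M95_dsum by (simp only: dsum2_scale) simp
qed

lemma M117_formula:
  "count_sub M117 G =
        1/2 * (\<Sum>(i, j)\<in>arcs G. adj_pow G 3 i i * (deg G j - 1)) - 6 * count_sub M7 G - 2 * count_sub M15 G - 4 * count_sub M31 G"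
using M117_dsum by (simp add: sum_arcs)

text \<open>Since \<open>r\<close> is adjacent to both \<open>i\<close> and \<open>j\<close>, the
  filter \<open>k r > 1\<close> keeps all common neighbours. If \<open>k i\<close> or
  \<open>k j\<close> is at most 2, then \<open>g2 i j\<close> is 1 and kills the factor, or 0 and
  empties the inner sum.\<close>

lemma M119_formula:
  "count_sub M119 G =
        (\<Sum>(i, j)\<in>{(i, j) \<in> orient (edges G). deg G i > 2 \<and> deg G j > 2}. (adj_pow G 2 i j - 1) * (\<Sum>r\<in>{r \<in> common_nbrs G i j. deg G r > 1}. deg G r - 2)) - 12 * count_sub M63 G"
proof -
  let ?R = "\<lambda>i j. \<Sum>r\<in>{r \<in> common_nbrs G i j. k r > 1}. k r - 2"
  have R: "?R i j = (\<Sum>r\<in>V. a i r * a r j * (k r - 2))" if "a i j = 1" for i j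
  proof -
    have "k r > 1" if "r \<in> common_nbrs G i j" for r
    proof -
      have "a r i = 1" "a r j = 1" using that by (auto simp: common_nbrs_def nbrs_iff a_commute)
      moreover have "i \<noteq> j" using \<open>a i j = 1\<close> by auto
      ultimately have "2 \<le> k r" by (rule deg_ge_2)
      then show ?thesis by simp
    qed
    then have "{r \<in> common_nbrs G i j. k r > 1} = common_nbrs G i j" by blast
    then show ?thesis by (simp add: sum_common_nbrs)
  qed
  have "2 * (\<Sum>(i, j)\<in>{(i, j) \<in> orient (edges G). k i > 2 \<and> k j > 2}. (g2 i j - 1) * ?R i j) =
      dsum2 V (\<lambda>i j. a i j * ((g2 i j - 1) * (\<Sum>r\<in>V. a i r * a r j * (k r - 2))))"
  proof (rule sum_edges_filter)
    show "(g2 i j - 1) * ?R i j = (g2 j i - 1) * ?R j i" for i j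
      by (simp add: g2_commute common_nbrs_commute)
  next
    fix i j assume a: "a i j = 1"
    have "(g2 i j - 1) * ?R i j = 0" if "\<not> (k i > 2 \<and> k j > 2)"
    proof -
      have "g2 i j = 0 \<or> g2 i j = 1"
        using that g2_le_deg[of i j] g2_le_deg'[of i j] a by (intro g2_le1) auto
      then show ?thesis using g2_eq_0_imp[of i j] by auto
    qed
    then show "(if k i > 2 \<and> k j > 2 then (g2 i j - 1) * ?R i j else 0) =
        (g2 i j - 1) * (\<Sum>r\<in>V. a i r * a r j * (k r - 2))"
      using R[OF a] by auto
  qed auto
  then show ?thesis using M119_dsum by (simp add: mult.assoc)
qed

lemma M127_formula:
  "count_sub M127 G =
        (\<Sum>i\<in>{i \<in> verts G. deg G i > 3}. count_sub M7 (nbhd_graph G i) * (deg G i - 3)) \<and>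
      (\<Sum>i\<in>{i \<in> verts G. deg G i > 3}. count_sub M7 (nbhd_graph G i) * (deg G i - 3)) =
        1/6 * (\<Sum>i\<in>{i \<in> verts G. deg G i > 3}. adj_pow_trace (nbhd_graph G i) 3 * (deg G i - 3))"
proof -
  have tri: "dsum3 (nbrs G i) (\<lambda>x y z. a x y * (a x z * a z y)) = 6 * count_sub M7 (nbhd_graph G i)" for i
  proof -
    let ?b = "adj (nbhd_graph G i)"
    have "dsum3 (nbrs G i) (\<lambda>x y z. a x y * (a x z * a z y)) =
        dsum3 (nbrs G i) (\<lambda>x y z. ?b x y * (?b x z * ?b z y))"
      by (intro dsum3_cong) (simp add: adj_nbhd)
    then show ?thesis
      using simple_graph.triangle_count[OF nbhd_simple, of i] by (simp add: verts_nbhd)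
  qed
  have "6 * count_sub M127 G =
      dsum4 V (\<lambda>i x y z. a i x * a i y * a i z * ((k i - 3) * (a x y * (a x z * a z y))))"
    unfolding M127_dsum by (intro dsum4_cong) (simp add: mult_ac)
  also have "\<dots> = (\<Sum>i\<in>V. dsum3 (nbrs G i) (\<lambda>x y z. (k i - 3) * (a x y * (a x z * a z y))))"
    by (simp add: dsum4_def dsum3_nbrs)
  also have "\<dots> = (\<Sum>i\<in>V. 6 * (count_sub M7 (nbhd_graph G i) * (k i - 3)))"
    unfolding dsum3_scale tri by (simp add: mult_ac)
  also have "\<dots> = 6 * (\<Sum>i\<in>{i \<in> V. k i > 3}. count_sub M7 (nbhd_graph G i) * (k i - 3))"
  proof -
    \<comment> \<open>At \<open>k i = 3\<close> the factor vanishes; below 3 the neighbourhood has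
      no room for a triangle.\<close>
    have "count_sub M7 (nbhd_graph G i) * (k i - 3) = 0" if "\<not> k i > 3" for i
    proof (cases "k i = 3")
      case False
      then have "count_sub M7 (nbhd_graph G i) = 0"
        using that by (intro count_sub_eq_0) (auto simp: verts_nbhd M7_def deg_card)
      then show ?thesis by simp
    qed simp
    then show ?thesis
      by (subst sum_filter) (auto simp: sum_distrib_left)
  qed
  finally show ?thesis
    by (simp add: simple_graph.trace3[OF nbhd_simple] sum_distrib_left[symmetric] mult.assoc)
qed

lemma M222_formula:
  "count_sub M222 G =
        1/2 * (\<Sum>(i, j)\<in>{(i, j) \<in> distinct_pairs (verts G). deg G i > 2 \<and> deg G j > 2}. adj_pow G 2 i j gchoose 3) \<and>
      1/2 * (\<Sum>(i, j)\<in>{(i, j) \<in> distinct_pairs (verts G). deg G i > 2 \<and> deg G j > 2}. adj_pow G 2 i j gchoose 3) =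
        1/12 * (\<Sum>(i, j)\<in>{(i, j) \<in> distinct_pairs (verts G). deg G i > 2 \<and> deg G j > 2}. adj_pow G 2 i j * (adj_pow G 2 i j - 1) * (adj_pow G 2 i j - 2))"
proof -
  let ?S = "{(i, j) \<in> distinct_pairs V. k i > 2 \<and> k j > 2}"
  have "(\<Sum>(i, j)\<in>?S. g2 i j * (g2 i j - 1) * (g2 i j - 2)) = dsum2 V (\<lambda>i j. g2 i j * (g2 i j - 1) * (g2 i j - 2))"
  proof (rule sum_distinct_pairs_filter)
    fix i j
    show "(if k i > 2 \<and> k j > 2 then g2 i j * (g2 i j - 1) * (g2 i j - 2) else 0) =
        g2 i j * (g2 i j - 1) * (g2 i j - 2)"
      using g2_le_deg[of i j] g2_le_deg'[of i j] a_cases[of i j] g2_le2[of i j] by auto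
  qed
  moreover have "(\<Sum>(i, j)\<in>?S. g2 i j gchoose 3) = 1/6 * (\<Sum>(i, j)\<in>?S. g2 i j * (g2 i j - 1) * (g2 i j - 2))"
    unfolding sum_distrib_left by (intro sum.cong refl) (auto simp: gchoose_expand)
  ultimately show ?thesis using M222_dsum by simp
qed

lemma M223_formula:
  "count_sub M223 G =
        1/2 * (\<Sum>(i, j)\<in>{(i, j) \<in> distinct_pairs (verts G). deg G i > 3 \<and> deg G j > 3}. (adj_pow G 2 i j * adj G i j) gchoose 3) \<and>
      1/2 * (\<Sum>(i, j)\<in>{(i, j) \<in> distinct_pairs (verts G). deg G i > 3 \<and> deg G j > 3}. (adj_pow G 2 i j * adj G i j) gchoose 3) =
        1/6 * (\<Sum>(i, j)\<in>{(i, j) \<in> orient (edges G). deg G i > 3 \<and> deg G j > 3}. adj_pow G 2 i j * (adj_pow G 2 i j - 1) * (adj_pow G 2 i j - 2))"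
proof -
  have "(\<Sum>(i, j)\<in>{(i, j) \<in> distinct_pairs V. k i > 3 \<and> k j > 3}. (g2 i j * a i j) gchoose 3) =
      dsum2 V (\<lambda>i j. 1/6 * (a i j * (g2 i j * (g2 i j - 1) * (g2 i j - 2))))"
  proof (rule sum_distinct_pairs_filter)
    fix i j
    show "(if k i > 3 \<and> k j > 3 then (g2 i j * a i j) gchoose 3 else 0) =
        1/6 * (a i j * (g2 i j * (g2 i j - 1) * (g2 i j - 2)))"
      using g2_le_deg[of i j] g2_le_deg'[of i j] a_cases[of i j] g2_le2[of i j] by (auto simp: gchoose_expand)
  qed
  moreover have "2 * (\<Sum>(i, j)\<in>{(i, j) \<in> orient (edges G). k i > 3 \<and> k j > 3}. g2 i j * (g2 i j - 1) * (g2 i j - 2)) =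
      dsum2 V (\<lambda>i j. a i j * (g2 i j * (g2 i j - 1) * (g2 i j - 2)))"
  proof (rule sum_edges_filter)
    fix i j assume "a i j = 1"
    then show "(if k i > 3 \<and> k j > 3 then g2 i j * (g2 i j - 1) * (g2 i j - 2) else 0) =
        g2 i j * (g2 i j - 1) * (g2 i j - 2)"
      using g2_le_deg[of i j] g2_le_deg'[of i j] g2_le2[of i j] by auto
  qed (auto simp: g2_commute)
  ultimately show ?thesis using M223_dsum by (simp only: dsum2_scale) simp
qed

lemma M235_formula:
  "count_sub M235 G =
        (\<Sum>i\<in>{i \<in> verts G. deg G i > 2}. (1/2 * adj_pow G 3 i i) gchoose 2) - 2 * count_sub M31 G \<and>
      (\<Sum>i\<in>{i \<in> verts G. deg G i > 2}. (1/2 * adj_pow G 3 i i) gchoose 2) - 2 * count_sub M31 G =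
        1/8 * (\<Sum>i\<in>{i \<in> verts G. deg G i > 2}. adj_pow G 3 i i * (adj_pow G 3 i i - 2)) - 2 * count_sub M31 G"
proof -
  have "(\<Sum>i\<in>{i \<in> V. k i > 2}. g3 i i * (g3 i i - 2)) = (\<Sum>i\<in>V. g3 i i * (g3 i i - 2))"
    by (rule sum_filter) (use deg_le2 g3_self_eq_0 g3_self_deg_2 in fastforce)
  moreover have "(\<Sum>i\<in>{i \<in> V. k i > 2}. (1/2 * g3 i i) gchoose 2) =
      1/8 * (\<Sum>i\<in>{i \<in> V. k i > 2}. g3 i i * (g3 i i - 2))"
    unfolding sum_distrib_left by (intro sum.cong refl) (auto simp: gchoose_expand field_simps)
  ultimately show ?thesis using M235_sum by simp
qed

lemma M236_formula:
  "count_sub M236 G =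
        1/10 * (adj_pow_trace G 5 - 30 * count_sub M7 G - 10 * count_sub M15 G)"
using M236_trace by simp

lemma M237_formula:
  "count_sub M237 G =
        (\<Sum>(i, j)\<in>orient (edges G). adj_pow G 3 i j * adj_pow G 2 i j) - 9 * count_sub M7 G - 2 * count_sub M15 G - 4 * count_sub M31 G"
proof -
  \<comment> \<open>\<open>sum_edges\<close> asks for a symmetric summand.\<close>
  have g3_commute: "g3 i j = g3 j i" for i j
  proof -
    have "g3 j i = (\<Sum>v\<in>V. g2 j v * a v i)"
      using adj_pow_Suc[of 2 j i] by (simp add: numeral_3_eq_3 numeral_2_eq_2)
    also have "\<dots> = g3 i j"
      unfolding sum_ag2'[symmetric] by (simp add: a_commute mult.commute)
    finally show ?thesis by simp
  qed
  have "2 * (\<Sum>(i, j)\<in>orient (edges G). g3 i j * g2 i j) = dsum2 V (\<lambda>i j. a i j * (g3 i j * g2 i j))"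
    by (rule sum_edges) (simp add: g2_commute g3_commute)
  then show ?thesis using M237_dsum by simp
qed

lemma M239_formula:
  "count_sub M239 G =
        (\<Sum>i\<in>{i \<in> verts G. deg G i > 3}. count_sub M13 (nbhd_graph G i)) \<and>
      (\<Sum>i\<in>{i \<in> verts G. deg G i > 3}. count_sub M13 (nbhd_graph G i)) =
        (\<Sum>i\<in>{i \<in> verts G. deg G i > 3}. (\<Sum>(j, r)\<in>orient (edges (nbhd_graph G i)). (deg (nbhd_graph G i) j - 1) * (deg (nbhd_graph G i) r - 1)) - 3 * count_sub M7 (nbhd_graph G i))"
proof -
  have "dsum5 V (\<lambda>i x y z w. a i x * a i y * a i z * a i w * (a x y * a x z * a y w)) =
      2 * (\<Sum>i\<in>{i \<in> V. k i > 3}. count_sub M13 (nbhd_graph G i))"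
    by (rule sum_count_nbhd[where f = "\<lambda>a x y z w. a x y * a x z * a y w"])
      (auto simp: simple_graph.M13_count M13_def)
  then show ?thesis
    using M239_dsum by (simp add: simple_graph.M13_edges[OF nbhd_simple])
qed

text \<open>\<open>i\<close> and \<open>j\<close> are common neighbours of \<open>r\<close> and
  \<open>q\<close>, so \<open>g2 r q\<close> is at least 2; if \<open>k r\<close> or
  \<open>k q\<close> is at most 2, it is exactly 2 and the term is 0. If \<open>k i\<close> or
  \<open>k j\<close> is at most 2, \<open>i\<close> and \<open>j\<close> have at most one common
  neighbour and there is no pair. Two sums over unordered pairs account for the factor 4 in
  \<open>M254_dsum\<close>.\<close>

lemma M254_formula:
  "count_sub M254 G =
        (\<Sum>(i, j)\<in>{(i, j) \<in> orient (edges G). deg G i > 2 \<and> deg G j > 2}. \<Sum>(r, q)\<in>{(r, q) \<in> orient (unordered_pairs (common_nbrs G i j)). deg G r > 2 \<and> deg G q > 2}. adj_pow G 2 r q - 2)"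
proof -
  let ?R = "\<lambda>i j. \<Sum>(r, q)\<in>{(r, q) \<in> orient (unordered_pairs (common_nbrs G i j)). k r > 2 \<and> k q > 2}. g2 r q - 2"
  have R: "2 * ?R i j = dsum2 (common_nbrs G i j) (\<lambda>r q. g2 r q - 2)" if "i \<noteq> j" for i j
  proof -
    have "2 * ?R i j = dsum2 (common_nbrs G i j)
        (\<lambda>r q. if {r, q} \<in> unordered_pairs (common_nbrs G i j) \<and> k r > 2 \<and> k q > 2 then g2 r q - 2 else 0)"
      by (rule sum_orient) (auto simp: g2_commute)
    also have "\<dots> = dsum2 (common_nbrs G i j) (\<lambda>r q. g2 r q - 2)"
    proof (rule dsum2_cong)
      fix r q assume rq: "r \<in> common_nbrs G i j" "q \<in> common_nbrs G i j" "r \<noteq> q"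
      then have "{r, q} \<in> unordered_pairs (common_nbrs G i j)" by (simp add: unordered_pairs_def)
      moreover have "{i, j} \<subseteq> common_nbrs G r q"
        using rq by (auto simp: common_nbrs_def nbrs_iff a_commute)
      then have "card {i, j} \<le> card (common_nbrs G r q)" by (intro card_mono) auto
      then have "2 \<le> g2 r q" using that by (simp add: g2_card)
      ultimately show "(if {r, q} \<in> unordered_pairs (common_nbrs G i j) \<and> k r > 2 \<and> k q > 2 then g2 r q - 2 else 0) = g2 r q - 2"
        using g2_le_deg[of r q] g2_le_deg'[of r q] a_cases[of r q] by auto
    qed
    finally show ?thesis .
  qed
  have "2 * (\<Sum>(i, j)\<in>{(i, j) \<in> orient (edges G). k i > 2 \<and> k j > 2}. ?R i j) =
      dsum2 V (\<lambda>i j. a i j * ?R i j)"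
  proof (rule sum_edges_filter)
    fix i j assume a: "a i j = 1"
    have "?R i j = 0" if "\<not> (k i > 2 \<and> k j > 2)"
    proof -
      have "g2 i j \<le> 1" using that g2_le_deg[of i j] g2_le_deg'[of i j] a by auto
      then have "card (common_nbrs G i j) \<le> Suc 0" by (simp add: g2_card)
      then have "dsum2 (common_nbrs G i j) (\<lambda>r q. g2 r q - 2) = 0"
        unfolding dsum2_def by (intro sum.neutral ballI) (auto simp: card_le_Suc0_iff_eq)
      moreover have ne: "i \<noteq> j" using a by auto
      ultimately show ?thesis using R[OF ne] by simp
    qed
    then show "(if k i > 2 \<and> k j > 2 then ?R i j else 0) = ?R i j" by auto
  qed (auto simp: common_nbrs_commute)
  also have "\<dots> = dsum2 V (\<lambda>i j. 1/2 * (a i j * dsum2 (common_nbrs G i j) (\<lambda>r q. g2 r q - 2)))"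
    by (intro dsum2_cong) (simp add: R[symmetric])
  also have "\<dots> = 1/2 * dsum2 V (\<lambda>i j. a i j * dsum2 (common_nbrs G i j) (\<lambda>r q. g2 r q - 2))"
    by (rule dsum2_scale)
  also have "dsum2 V (\<lambda>i j. a i j * dsum2 (common_nbrs G i j) (\<lambda>r q. g2 r q - 2)) = 4 * count_sub M254 G"
  proof -
    have "dsum2 (common_nbrs G i j) f = dsum2 (V - {i} - {j}) (\<lambda>r q. a i r * a r j * (a i q * a q j) * f r q)"
      for i j f
    proof (rule dsum2_restrict)
      show "common_nbrs G i j \<subseteq> V - {i} - {j}" using nbrs_subset by (auto simp: common_nbrs_def)
      show "a i x * a x j = 0" if "x \<in> V - {i} - {j} - common_nbrs G i j" for x
        using that a_cases[of i x] a_cases[of x j] by (auto simp: common_nbrs_iff)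
    qed (auto simp: common_nbrs_iff)
    then have "dsum2 V (\<lambda>i j. a i j * dsum2 (common_nbrs G i j) (\<lambda>r q. g2 r q - 2)) =
        dsum4 V (\<lambda>i j r q. a i j * (a i r * a r j * (a i q * a q j) * (g2 r q - 2)))"
      by (simp add: dsum4_def dsum3_def dsum2_def[of V] dsum2_scale)
    then show ?thesis using M254_dsum by (simp add: mult.assoc)
  qed
  finally show ?thesis by simp
qed

lemma M255_formula:
  "count_sub M255 G =
        1/2 * (\<Sum>i\<in>{i \<in> verts G. deg G i > 3}. count_sub M15 (nbhd_graph G i)) \<and>
      1/2 * (\<Sum>i\<in>{i \<in> verts G. deg G i > 3}. count_sub M15 (nbhd_graph G i)) =
        1/4 * (\<Sum>i\<in>{i \<in> verts G. deg G i > 3}. \<Sum>r\<in>{r \<in> nbrs G i. deg (nbhd_graph G i) r > 2}. adj_pow (nbhd_graph G i) 3 r r * (deg (nbhd_graph G i) r - 2))"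
proof -
  have "dsum5 V (\<lambda>i x y z w. a i x * a i y * a i z * a i w * (a x y * (a x z * a z y) * a x w)) =
      2 * (\<Sum>i\<in>{i \<in> V. k i > 3}. count_sub M15 (nbhd_graph G i))"
    by (rule sum_count_nbhd[where f = "\<lambda>a x y z w. a x y * (a x z * a z y) * a x w"])
      (auto simp: simple_graph.M15_count M15_def)
  then show ?thesis
    using M255_dsum simple_graph.M15_filter[OF nbhd_simple]
    by (simp add: verts_nbhd sum_distrib_left[symmetric])
qed

lemma M507_formula:
  "count_sub M507 G =
        (\<Sum>i\<in>{i \<in> verts G. deg G i > 3}. count_sub M30 (nbhd_graph G i)) \<and>
      (\<Sum>i\<in>{i \<in> verts G. deg G i > 3}. count_sub M30 (nbhd_graph G i)) =
        1/8 * (\<Sum>i\<in>{i \<in> verts G. deg G i > 3}. adj_pow_trace (nbhd_graph G i) 4 - 2 * real (card (edges (nbhd_graph G i))) - 4 * count_sub M3 (nbhd_graph G i))"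
proof -
  have "dsum5 V (\<lambda>i x y z w. a i x * a i y * a i z * a i w * (a x z * a z y * (a x w * a w y))) =
      8 * (\<Sum>i\<in>{i \<in> V. k i > 3}. count_sub M30 (nbhd_graph G i))"
    by (rule sum_count_nbhd[where f = "\<lambda>a x y z w. a x z * a z y * (a x w * a w y)"])
      (auto simp: simple_graph.M30_count M30_def)
  then show ?thesis
    using M507_dsum by (simp add: simple_graph.M30_trace[OF nbhd_simple, symmetric] sum_distrib_left[symmetric])
qed

lemma M511_formula:
  "count_sub M511 G =
        1/3 * (\<Sum>i\<in>{i \<in> verts G. deg G i > 3}. count_sub M31 (nbhd_graph G i)) \<and>
      1/3 * (\<Sum>i\<in>{i \<in> verts G. deg G i > 3}. count_sub M31 (nbhd_graph G i)) =
        1/6 * (\<Sum>i\<in>{i \<in> verts G. deg G i > 3}. \<Sum>(r, s)\<in>{(r, s) \<in> distinct_pairs (nbrs G i). deg (nbhd_graph G i) r > 2 \<and> deg (nbhd_graph G i) s > 2}. (adj_pow (nbhd_graph G i) 2 r s * adj (nbhd_graph G i) r s) gchoose 2)"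
proof -
  have "dsum5 V (\<lambda>i x y z w. a i x * a i y * a i z * a i w * (a x y * (a x z * a z y) * (a x w * a w y))) =
      4 * (\<Sum>i\<in>{i \<in> V. k i > 3}. count_sub M31 (nbhd_graph G i))"
    by (rule sum_count_nbhd[where f = "\<lambda>a x y z w. a x y * (a x z * a z y) * (a x w * a w y)"])
      (auto simp: simple_graph.M31_count M31_def)
  then show ?thesis
    using M511_dsum simple_graph.M31_pairs[OF nbhd_simple]
    by (simp add: verts_nbhd sum_distrib_left[symmetric])
qed

text \<open>A \<open>K4\<close> in the neighbourhood of \<open>i\<close> is a vertex
  \<open>j\<close> with a triangle in the common neighbourhood of \<open>i\<close> and
  \<open>j\<close>. With 5 choices of \<open>i\<close>, 4 of \<open>j\<close> and 6 closed 3-walks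
  per triangle this makes 120.\<close>

lemma M1023_formula:
  "count_sub M1023 G =
        1/5 * (\<Sum>i\<in>{i \<in> verts G. deg G i > 3}. count_sub M63 (nbhd_graph G i)) \<and>
      1/5 * (\<Sum>i\<in>{i \<in> verts G. deg G i > 3}. count_sub M63 (nbhd_graph G i)) =
        1/120 * (\<Sum>i\<in>{i \<in> verts G. deg G i > 3}. \<Sum>j\<in>{j \<in> nbrs G i. deg G j > 2}. adj_pow_trace (induced G (common_nbrs G i j)) 3)"
proof -
  have "dsum5 V (\<lambda>i x y z w. a i x * a i y * a i z * a i w * (a x y * a x z * a x w * (a y z * (a y w * a w z)))) =
      24 * (\<Sum>i\<in>{i \<in> V. k i > 3}. count_sub M63 (nbhd_graph G i))"
    by (rule sum_count_nbhd[where f = "\<lambda>a x y z w. a x y * a x z * a x w * (a y z * (a y w * a w z))"])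
      (auto simp: simple_graph.M63_count M63_def)
  moreover have K4: "24 * count_sub M63 (nbhd_graph G i) =
      (\<Sum>j\<in>{j \<in> nbrs G i. k j > 2}. adj_pow_trace (induced G (common_nbrs G i j)) 3)" for i
  proof -
    let ?b = "adj (nbhd_graph G i)"
    let ?T = "\<lambda>y z w. a y z * (a y w * a w z)"
    have sub: "common_nbrs G i j \<subseteq> V" for j using nbrs_subset by (auto simp: common_nbrs_def)
    have tr: "adj_pow_trace (induced G (common_nbrs G i j)) 3 = dsum3 (common_nbrs G i j) ?T" for j
    proof -
      let ?c = "adj (induced G (common_nbrs G i j))"
      have "dsum3 (common_nbrs G i j) ?T = dsum3 (common_nbrs G i j) (\<lambda>y z w. ?c y z * (?c y w * ?c w z))"
        by (intro dsum3_cong) (simp add: adj_induced)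
      then show ?thesis
        using simple_graph.triangle_count[OF induced_simple[OF sub], of j]
          simple_graph.trace3[OF induced_simple[OF sub], of j] by (simp add: verts_induced)
    qed
    have "24 * count_sub M63 (nbhd_graph G i) =
        dsum4 (nbrs G i) (\<lambda>x y z w. ?b x y * ?b x z * ?b x w * (?b y z * (?b y w * ?b w z)))"
      using simple_graph.M63_count[OF nbhd_simple, of i] by (simp add: verts_nbhd)
    also have "\<dots> = dsum4 (nbrs G i) (\<lambda>x y z w. a x y * a x z * a x w * ?T y z w)"
      by (intro dsum4_cong) (simp add: adj_nbhd)
    also have "\<dots> = (\<Sum>x\<in>nbrs G i. dsum3 (common_nbrs G i x) ?T)"
    proof -
      have "dsum3 (common_nbrs G i x) ?T = dsum3 (nbrs G i - {x}) (\<lambda>y z w. a x y * a x z * a x w * ?T y z w)" for x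
        using a_cases by (intro dsum3_restrict) (auto simp: common_nbrs_def nbrs_iff)
      then show ?thesis by (simp add: dsum4_def)
    qed
    also have "\<dots> = (\<Sum>j\<in>{j \<in> nbrs G i. k j > 2}. dsum3 (common_nbrs G i j) ?T)"
    proof (rule sum.mono_neutral_right)
      \<comment> \<open>With fewer than three neighbours, \<open>j\<close> leaves no room for a
        triangle among the common ones.\<close>
      show "\<forall>j\<in>nbrs G i - {j \<in> nbrs G i. k j > 2}. dsum3 (common_nbrs G i j) ?T = 0"
      proof
        fix j assume "j \<in> nbrs G i - {j \<in> nbrs G i. k j > 2}"
        then have "card (nbrs G j) < 3" by (auto simp: deg_card)
        moreover have "card (common_nbrs G i j) \<le> card (nbrs G j)"
          by (intro card_mono) (auto simp: common_nbrs_def)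
        ultimately have "count_sub M7 (induced G (common_nbrs G i j)) = 0"
          by (intro count_sub_eq_0) (auto simp: verts_induced M7_def)
        then show "dsum3 (common_nbrs G i j) ?T = 0"
          using tr[of j] simple_graph.trace3[OF induced_simple[OF sub], of j] by simp
      qed
    qed auto
    finally show ?thesis by (simp add: tr)
  qed
  ultimately show ?thesis
    using M1023_dsum by (simp add: K4[symmetric] sum_distrib_left[symmetric])
qed

end

theorem theorem1:
  fixes G :: "'a graph"
  assumes "finite_simple_graph G"
  shows
    "(count_sub M75 G =
        (\<Sum>i\<in>{i \<in> verts G. deg G i > 3}. deg G i gchoose 4) \<and>
      (\<Sum>i\<in>{i \<in> verts G. deg G i > 3}. deg G i gchoose 4) =
        1/24 * (\<Sum>i\<in>{i \<in> verts G. deg G i > 3}. deg G i * (deg G i - 1) * (deg G i - 2) * (deg G i - 3))) \<and>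
     (count_sub M77 G =
        (\<Sum>(i, j)\<in>{(i, j) \<in> arcs G. deg G i > 2}. ((deg G i - 1) gchoose 2) * (deg G j - 1)) - 2 * count_sub M15 G \<and>
      (\<Sum>(i, j)\<in>{(i, j) \<in> arcs G. deg G i > 2}. ((deg G i - 1) gchoose 2) * (deg G j - 1)) - 2 * count_sub M15 G =
        1/2 * (\<Sum>(i, j)\<in>{(i, j) \<in> arcs G. deg G i > 2}. (deg G i - 1) * (deg G i - 2) * (deg G j - 1)) - 2 * count_sub M15 G) \<and>
     (count_sub M79 G =
        1/2 * (\<Sum>i\<in>{i \<in> verts G. deg G i > 3}. adj_pow G 3 i i * ((deg G i - 2) gchoose 2)) \<and>
      1/2 * (\<Sum>i\<in>{i \<in> verts G. deg G i > 3}. adj_pow G 3 i i * ((deg G i - 2) gchoose 2)) =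
        1/4 * (\<Sum>i\<in>{i \<in> verts G. deg G i > 3}. adj_pow G 3 i i * (deg G i - 2) * (deg G i - 3))) \<and>
     (count_sub M86 G =
        1/2 * (\<Sum>(i, j)\<in>distinct_pairs (verts G). adj_pow G 4 i j) - 2 * count_sub M3 G - 9 * count_sub M7 G - 3 * count_sub M11 G - 2 * count_sub M13 G - 2 * count_sub M15 G) \<and>
     (count_sub M87 G =
        (\<Sum>(i, j)\<in>{(i, j) \<in> orient (edges G). deg G i > 2 \<and> deg G j > 2}. adj_pow G 2 i j * (deg G i - 2) * (deg G j - 2)) - 2 * count_sub M31 G) \<and>
     (count_sub M94 G =
        (\<Sum>(i, j)\<in>{(i, j) \<in> distinct_pairs (verts G). deg G i > 2}. (adj_pow G 2 i j gchoose 2) * (deg G i - 2)) - 2 * count_sub M31 G \<and>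
      (\<Sum>(i, j)\<in>{(i, j) \<in> distinct_pairs (verts G). deg G i > 2}. (adj_pow G 2 i j gchoose 2) * (deg G i - 2)) - 2 * count_sub M31 G =
        1/2 * (\<Sum>(i, j)\<in>{(i, j) \<in> distinct_pairs (verts G). deg G i > 2}. adj_pow G 2 i j * (adj_pow G 2 i j - 1) * (deg G i - 2)) - 2 * count_sub M31 G) \<and>
     (count_sub M95 G =
        (\<Sum>(i, j)\<in>{(i, j) \<in> distinct_pairs (verts G). deg G i > 3}. ((adj_pow G 2 i j * adj G i j) gchoose 2) * (deg G i - 3)) \<and>
      (\<Sum>(i, j)\<in>{(i, j) \<in> distinct_pairs (verts G). deg G i > 3}. ((adj_pow G 2 i j * adj G i j) gchoose 2) * (deg G i - 3)) =
        1/2 * (\<Sum>(i, j)\<in>{(i, j) \<in> arcs G. deg G i > 3}. adj_pow G 2 i j * (adj_pow G 2 i j - 1) * (deg G i - 3))) \<and>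
     (count_sub M117 G =
        1/2 * (\<Sum>(i, j)\<in>arcs G. adj_pow G 3 i i * (deg G j - 1)) - 6 * count_sub M7 G - 2 * count_sub M15 G - 4 * count_sub M31 G) \<and>
     (count_sub M119 G =
        (\<Sum>(i, j)\<in>{(i, j) \<in> orient (edges G). deg G i > 2 \<and> deg G j > 2}. (adj_pow G 2 i j - 1) * (\<Sum>r\<in>{r \<in> common_nbrs G i j. deg G r > 1}. deg G r - 2)) - 12 * count_sub M63 G) \<and>
     (count_sub M127 G =
        (\<Sum>i\<in>{i \<in> verts G. deg G i > 3}. count_sub M7 (nbhd_graph G i) * (deg G i - 3)) \<and>
      (\<Sum>i\<in>{i \<in> verts G. deg G i > 3}. count_sub M7 (nbhd_graph G i) * (deg G i - 3)) =
        1/6 * (\<Sum>i\<in>{i \<in> verts G. deg G i > 3}. adj_pow_trace (nbhd_graph G i) 3 * (deg G i - 3))) \<and>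
     (count_sub M222 G =
        1/2 * (\<Sum>(i, j)\<in>{(i, j) \<in> distinct_pairs (verts G). deg G i > 2 \<and> deg G j > 2}. adj_pow G 2 i j gchoose 3) \<and>
      1/2 * (\<Sum>(i, j)\<in>{(i, j) \<in> distinct_pairs (verts G). deg G i > 2 \<and> deg G j > 2}. adj_pow G 2 i j gchoose 3) =
        1/12 * (\<Sum>(i, j)\<in>{(i, j) \<in> distinct_pairs (verts G). deg G i > 2 \<and> deg G j > 2}. adj_pow G 2 i j * (adj_pow G 2 i j - 1) * (adj_pow G 2 i j - 2))) \<and>
     (count_sub M223 G =
        1/2 * (\<Sum>(i, j)\<in>{(i, j) \<in> distinct_pairs (verts G). deg G i > 3 \<and> deg G j > 3}. (adj_pow G 2 i j * adj G i j) gchoose 3) \<and>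
      1/2 * (\<Sum>(i, j)\<in>{(i, j) \<in> distinct_pairs (verts G). deg G i > 3 \<and> deg G j > 3}. (adj_pow G 2 i j * adj G i j) gchoose 3) =
        1/6 * (\<Sum>(i, j)\<in>{(i, j) \<in> orient (edges G). deg G i > 3 \<and> deg G j > 3}. adj_pow G 2 i j * (adj_pow G 2 i j - 1) * (adj_pow G 2 i j - 2))) \<and>
     (count_sub M235 G =
        (\<Sum>i\<in>{i \<in> verts G. deg G i > 2}. (1/2 * adj_pow G 3 i i) gchoose 2) - 2 * count_sub M31 G \<and>
      (\<Sum>i\<in>{i \<in> verts G. deg G i > 2}. (1/2 * adj_pow G 3 i i) gchoose 2) - 2 * count_sub M31 G =
        1/8 * (\<Sum>i\<in>{i \<in> verts G. deg G i > 2}. adj_pow G 3 i i * (adj_pow G 3 i i - 2)) - 2 * count_sub M31 G) \<and>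
     (count_sub M236 G =
        1/10 * (adj_pow_trace G 5 - 30 * count_sub M7 G - 10 * count_sub M15 G)) \<and>
     (count_sub M237 G =
        (\<Sum>(i, j)\<in>orient (edges G). adj_pow G 3 i j * adj_pow G 2 i j) - 9 * count_sub M7 G - 2 * count_sub M15 G - 4 * count_sub M31 G) \<and>
     (count_sub M239 G =
        (\<Sum>i\<in>{i \<in> verts G. deg G i > 3}. count_sub M13 (nbhd_graph G i)) \<and>
      (\<Sum>i\<in>{i \<in> verts G. deg G i > 3}. count_sub M13 (nbhd_graph G i)) =
        (\<Sum>i\<in>{i \<in> verts G. deg G i > 3}. (\<Sum>(j, r)\<in>orient (edges (nbhd_graph G i)). (deg (nbhd_graph G i) j - 1) * (deg (nbhd_graph G i) r - 1)) - 3 * count_sub M7 (nbhd_graph G i))) \<and>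
     (count_sub M254 G =
        (\<Sum>(i, j)\<in>{(i, j) \<in> orient (edges G). deg G i > 2 \<and> deg G j > 2}. \<Sum>(r, q)\<in>{(r, q) \<in> orient (unordered_pairs (common_nbrs G i j)). deg G r > 2 \<and> deg G q > 2}. adj_pow G 2 r q - 2)) \<and>
     (count_sub M255 G =
        1/2 * (\<Sum>i\<in>{i \<in> verts G. deg G i > 3}. count_sub M15 (nbhd_graph G i)) \<and>
      1/2 * (\<Sum>i\<in>{i \<in> verts G. deg G i > 3}. count_sub M15 (nbhd_graph G i)) =
        1/4 * (\<Sum>i\<in>{i \<in> verts G. deg G i > 3}. \<Sum>r\<in>{r \<in> nbrs G i. deg (nbhd_graph G i) r > 2}. adj_pow (nbhd_graph G i) 3 r r * (deg (nbhd_graph G i) r - 2))) \<and>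
     (count_sub M507 G =
        (\<Sum>i\<in>{i \<in> verts G. deg G i > 3}. count_sub M30 (nbhd_graph G i)) \<and>
      (\<Sum>i\<in>{i \<in> verts G. deg G i > 3}. count_sub M30 (nbhd_graph G i)) =
        1/8 * (\<Sum>i\<in>{i \<in> verts G. deg G i > 3}. adj_pow_trace (nbhd_graph G i) 4 - 2 * real (card (edges (nbhd_graph G i))) - 4 * count_sub M3 (nbhd_graph G i))) \<and>
     (count_sub M511 G =
        1/3 * (\<Sum>i\<in>{i \<in> verts G. deg G i > 3}. count_sub M31 (nbhd_graph G i)) \<and>
      1/3 * (\<Sum>i\<in>{i \<in> verts G. deg G i > 3}. count_sub M31 (nbhd_graph G i)) =
        1/6 * (\<Sum>i\<in>{i \<in> verts G. deg G i > 3}. \<Sum>(r, s)\<in>{(r, s) \<in> distinct_pairs (nbrs G i). deg (nbhd_graph G i) r > 2 \<and> deg (nbhd_graph G i) s > 2}. (adj_pow (nbhd_graph G i) 2 r s * adj (nbhd_graph G i) r s) gchoose 2)) \<and>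
     (count_sub M1023 G =
        1/5 * (\<Sum>i\<in>{i \<in> verts G. deg G i > 3}. count_sub M63 (nbhd_graph G i)) \<and>
      1/5 * (\<Sum>i\<in>{i \<in> verts G. deg G i > 3}. count_sub M63 (nbhd_graph G i)) =
        1/120 * (\<Sum>i\<in>{i \<in> verts G. deg G i > 3}. \<Sum>j\<in>{j \<in> nbrs G i. deg G j > 2}. adj_pow_trace (induced G (common_nbrs G i j)) 3))"
proof -
  interpret simple_graph G
    using assms by (simp add: simple_graph_def)
  show ?thesis
    by (intro conjI M75_formula[THEN conjunct1] M75_formula[THEN conjunct2] M77_formula[THEN
      conjunct1] M77_formula[THEN conjunct2] M79_formula[THEN conjunct1] M79_formula[THEN
      conjunct2] M86_formula M87_formula M94_formula[THEN conjunct1] M94_formula[THEN conjunct2]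
      M95_formula[THEN conjunct1] M95_formula[THEN conjunct2] M117_formula M119_formula
      M127_formula[THEN conjunct1] M127_formula[THEN conjunct2] M222_formula[THEN conjunct1]
      M222_formula[THEN conjunct2] M223_formula[THEN conjunct1] M223_formula[THEN conjunct2]
      M235_formula[THEN conjunct1] M235_formula[THEN conjunct2] M236_formula M237_formula
      M239_formula[THEN conjunct1] M239_formula[THEN conjunct2] M254_formula M255_formula[THEN
      conjunct1] M255_formula[THEN conjunct2] M507_formula[THEN conjunct1] M507_formula[THEN
      conjunct2] M511_formula[THEN conjunct1] M511_formula[THEN conjunct2] M1023_formula[THEN
      conjunct1] M1023_formula[THEN conjunct2])
qed

end
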